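(* Let $\Xi=\mathbb{R}^k$ or $\Xi=\mathbb{R}^k_+$, let $x\in\mathbb{R}^{n_x}$, let the standing assumptions on the second-stage problem (complete recourse and $\Pi$ having an interior point) hold, and let $\epsilon>0$. Let $\lambda^*$ be an optimal Lagrange multiplier of $\sup_{\mathbb{P}\in\mathcal{P}^2_{N,\epsilon}}\mathbb{E}_{\mathbb{P}}[Z(x,\tilde\xi)]$ (so $\lambda^*>0$), and for $i\in[N]$ let $$\Pi^*_{i,x,\lambda^*}:=\arg\max_{\pi\in\Pi}\Big\{\pi^\top(Tx+\zeta^i)+\frac{1}{4\lambda^*}\|\pi\|_q^2\Big\}.$$ Then there exist weights $(\mu^i_\pi)_{\pi\in\Pi^*_{i,x,\lambda^*}}\ge0$ with $\sum_{\pi\in\Pi^*_{i,x,\lambda^*}}\mu^i_\pi=1$ for all $i\in[N]$ such that $$\frac1N\sum_{i\in[N]}\sum_{\pi\in\Pi^*_{i,x,\lambda^*}}\mu^i_\pi\,\frac{\|\pi\|_q^2}{4(\lambda^* )^2}=\epsilon^2,$$ and, with such weights, $\sup_{\mathbb{P}\in\mathcal{P}^2_{N,\epsilon}}\mathbb{E}_{\mathbb{P}}[Z(x,\tilde\xi)]$ is attained by the probability distribution $$\mathbb{Q}_x=\frac1N\sum_{i\in[N]}\sum_{\pi\in\Pi^*_{i,x,\lambda^*}}\mu^i_\pi\,\delta_{\zeta^i+\frac{\|\pi\|_q}{2\lambda^*}d_\pi},\qquad d_\pi:=\frac{\pi^{q-1}}{\|\pi\|_q^{q-1}}.$$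
   Context: Setting. Let $n_x,n_y,k,N$ be positive integers, $[N]=\{1,\dots,N\}$. Let $\mathcal{K}_y\subseteq\mathbb{R}^{n_y}$ be a Cartesian product of finitely many proper cones, with dual cone $\mathcal{K}_y^*=\{v: v^\top y\ge 0\ \forall y\in\mathcal{K}_y\}$, and write $a\preceq_{\mathcal{K}_y^*}b$ for $b-a\in\mathcal{K}_y^*$. Let $\mathbf{q}\in\mathbb{R}^{n_y}$ (cost vector), $W\in\mathbb{R}^{k\times n_y}$, $T\in\mathbb{R}^{k\times n_x}$. For $x\in\mathbb{R}^{n_x}$, $\xi\in\mathbb{R}^k$ define the second-stage cost $$Z(x,\xi):=\inf_{y\in\mathcal{K}_y}\{\mathbf{q}^\top y: Wy\ge Tx+\xi\},$$ and the dual feasible set $\Pi:=\{\pi\in\mathbb{R}^k:\pi\ge0,\ W^\top\pi\preceq_{\mathcal{K}_y^*}\mathbf{q}\}$. Standing assumptions: (i) complete recourse: for every right-hand side $h\in\mathbb{R}^k$ there is $y\in\mathcal{K}_y$ with $Wy\ge h$; (ii) $\Pi$ has an interior point. (Under these, $\Pi$ is compact.) Norms: $\|\cdot\|$ is the $l_p$-norm on $\mathbb{R}^k$ for some fixed $p\in[1,\infty]$, and the scalar $q\in[1,\infty]$ satisfies $1/p+1/q=1$, so $\|\cdot\|_q$ is the dual norm. For a vector $v$ and scalar $a$, $v^a$ is the componentwise power. Conventions: $\|\pi\|_q d_\pi:=0$ if $\pi=0$; if $q=1$, $0^0=1$; if $q=\infty$ and $\pi\neq0$, $d_\pi$ is read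 as the limit of the formula as $q\to\infty$, i.e. $(d_\pi)_j=1/m$ for the $m$ indices $j$ at which $\pi_j=\|\pi\|_\infty$ and $(d_\pi)_j=0$ otherwise. Sums over $\pi\in\Pi^*_{i,x,\lambda^*}$ are with weights $\mu^i_\pi$ nonzero for only finitely many $\pi$. Ambiguity set: given sample points $\zeta^1,\dots,\zeta^N\in\Xi$, let $\hat{\mathbb{P}}_N=\frac1N\sum_{i=1}^N\delta_{\zeta^i}$ ($\delta$ = Dirac measure). For $r\ge1$ let $\mathcal{P}^r(\Xi)$ be the set of Borel probability measures on $\Xi$ with finite $r$th moment, let $$W^r(\mathbb{Q}_1,\mathbb{Q}_2)=\inf_{\gamma}\Big(\int_{\Xi\times\Xi}\|\xi_1-\xi_2\|^r\,d\gamma(\xi_1,\xi_2)\Big)^{1/r}$$ where $\gamma$ ranges over couplings of $\mathbb{Q}_1,\mathbb{Q}_2$, and let $\mathcal{P}^r_{N,\epsilon}=\{\mathbb{Q}\in\mathcal{P}^r(\Xi):W^r(\mathbb{Q},\hat{\mathbb{P}}_N)\le\epsilon\}$. Here $\mathbb{E}_{\mathbb{P}}[Z(x,\tilde\xi)]=\int_\Xi Z(x,\xi)\,d\mathbb{P}(\xi)$. Optimal Lagrange multiplier: a minimizer $\lambda^*$ of the dual problem $$\min_{\lambda\ge0}\ \epsilon^2\lambda+\frac1N\sum_{i\in[N]}\sup_{\xi\in\Xi}\big\{Z(x,\xi)-\lambda\|\xi-\zeta^i\|^2\big\}.$$ It is known (and may be used) that for $\epsilon>0$ the minimum is attained and equals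 $\sup_{\mathbb{P}\in\mathcal{P}^2_{N,\epsilon}}\mathbb{E}_{\mathbb{P}}[Z(x,\tilde\xi)]$; the dual objective is $+\infty$ at $\lambda=0$. *)

theory Defs
  imports "HOL-Probability.Probability"
begin

(* A proper cone of the subspace V: closed, convex, pointed, and solid, where the interior
   is taken relative to V. *)
definition proper_cone_in :: "'a::euclidean_space set \<Rightarrow> 'a set \<Rightarrow> bool" where
  "proper_cone_in V C \<longleftrightarrow>
     C \<subseteq> V \<and> cone C \<and> convex C \<and> closed C \<and>
     (\<forall>v. v \<in> C \<and> - v \<in> C \<longrightarrow> v = 0) \<and>
     (top_of_set V) interior_of C \<noteq> {}"

definition coord_subspace :: "'n set \<Rightarrow> (real^'n) set" where
  "coord_subspace B = {y. \<forall>j. j \<notin> B \<longrightarrow> y $ j = 0}"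

definition coord_proj :: "'n set \<Rightarrow> real^'n \<Rightarrow> real^'n" where
  "coord_proj B y = (\<chi> j. if j \<in> B then y $ j else 0)"

(* The factors of the product correspond to the blocks of a partition of the coordinates;
   the factor space of a block B is identified with coord_subspace B. *)
definition product_of_proper_cones :: "(real^'n) set \<Rightarrow> bool" where
  "product_of_proper_cones K \<longleftrightarrow>
     (\<exists>P C. partition_on UNIV P \<and>
        (\<forall>B\<in>P. proper_cone_in (coord_subspace B) (C B)) \<and>
        K = {y. \<forall>B\<in>P. coord_proj B y \<in> C B})"

definition dual_cone :: "'a::euclidean_space set \<Rightarrow> 'a set" where
  "dual_cone K = {v. \<forall>y\<in>K. 0 \<le> v \<bullet> y}"

(* The order on real^'k is componentwise. The infimum is a real one: complete recourse makes the
   feasible set nonempty, and any element of dual_feasible bounds the objective from below. *)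
definition second_stage_cost ::
  "(real^'ny) set \<Rightarrow> real^'ny \<Rightarrow> real^'ny^'k \<Rightarrow> real^'nx^'k \<Rightarrow> real^'nx \<Rightarrow> real^'k \<Rightarrow> real" where
  "second_stage_cost K c W T x \<xi> = (INF y\<in>{y\<in>K. T *v x + \<xi> \<le> W *v y}. c \<bullet> y)"

definition dual_feasible :: "(real^'ny) set \<Rightarrow> real^'ny \<Rightarrow> real^'ny^'k \<Rightarrow> (real^'k) set" where
  "dual_feasible K c W = {\<pi>. 0 \<le> \<pi> \<and> c - transpose W *v \<pi> \<in> dual_cone K}"

definition complete_recourse :: "(real^'ny) set \<Rightarrow> real^'ny^'k \<Rightarrow> bool" where
  "complete_recourse K W \<longleftrightarrow> (\<forall>h. \<exists>y\<in>K. h \<le> W *v y)"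

definition lp_norm :: "ereal \<Rightarrow> real^'k \<Rightarrow> real" where
  "lp_norm p v =
     (if p = \<infinity> then infnorm v
      else (\<Sum>j\<in>UNIV. \<bar>v $ j\<bar> powr real_of_ereal p) powr (1 / real_of_ereal p))"

(* powr with the convention 0^0 = 1, whereas 0 powr 0 = 0 *)
definition rpow :: "real \<Rightarrow> real \<Rightarrow> real" where
  "rpow a b = (if b = 0 then 1 else a powr b)"

(* d_pi; used only for 0 \<le> \<pi>. For q = \<infinity> it is the limit of the formula as q tends to infinity.
   Its value at \<pi> = 0 is irrelevant, as it is always scaled by lp_norm q \<pi>. *)
definition dual_direction :: "ereal \<Rightarrow> real^'k \<Rightarrow> real^'k" where
  "dual_direction q \<pi> =
     (if q = \<infinity>
      then (\<chi> j. if \<pi> $ j = lp_norm \<infinity> \<pi> then 1 / real (card {l. \<pi> $ l = lp_norm \<infinity> \<pi>}) else 0)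
      else (\<chi> j. rpow (\<pi> $ j) (real_of_ereal q - 1) / rpow (lp_norm q \<pi>) (real_of_ereal q - 1)))"

(* Borel probability measures on \<Xi>, with carrier \<Xi> itself, and finite r-th moment *)
definition prob_moment :: "ereal \<Rightarrow> real \<Rightarrow> (real^'k) set \<Rightarrow> (real^'k) measure set" where
  "prob_moment p r \<Xi> =
     {Q. prob_space Q \<and> sets Q = sets (restrict_space borel \<Xi>) \<and>
         integrable Q (\<lambda>\<xi>. lp_norm p \<xi> powr r)}"

definition couplings :: "'a measure \<Rightarrow> 'b measure \<Rightarrow> ('a \<times> 'b) measure set" where
  "couplings Q1 Q2 =
     {\<gamma>. sets \<gamma> = sets (Q1 \<Otimes>\<^sub>M Q2) \<and> distr \<gamma> Q1 fst = Q1 \<and> distr \<gamma> Q2 snd = Q2}"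

definition ennreal_powr :: "ennreal \<Rightarrow> real \<Rightarrow> ennreal" where
  "ennreal_powr a s = (if a = \<infinity> then \<infinity> else ennreal (enn2real a powr s))"

definition wasserstein ::
  "ereal \<Rightarrow> real \<Rightarrow> (real^'k) measure \<Rightarrow> (real^'k) measure \<Rightarrow> ennreal" where
  "wasserstein p r Q1 Q2 =
     (INF \<gamma>\<in>couplings Q1 Q2.
        ennreal_powr (\<integral>\<^sup>+ z. ennreal (lp_norm p (fst z - snd z) powr r) \<partial>\<gamma>) (1 / r))"

(* The weighted sum of Dirac measures with weights w i at the points a i, for i in a finite set I,
   as a Borel measure on \<Xi>; see emeasure_dirac_sum. *)
definition dirac_sum ::
  "'a::topological_space set \<Rightarrow> 'i set \<Rightarrow> ('i \<Rightarrow> real) \<Rightarrow> ('i \<Rightarrow> 'a) \<Rightarrow> 'a measure" where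
  "dirac_sum \<Xi> I w a = distr (point_measure I (\<lambda>i. ennreal (w i))) (restrict_space borel \<Xi>) a"

lemma emeasure_dirac_sum:
  assumes "finite I" "a ` I \<subseteq> \<Xi>" "A \<in> sets (restrict_space borel \<Xi>)"
  shows "emeasure (dirac_sum \<Xi> I w a) A =
    (\<Sum>i\<in>I. ennreal (w i) * emeasure (return (restrict_space borel \<Xi>) (a i)) A)"
proof -
  have "a \<in> measurable (point_measure I (\<lambda>i. ennreal (w i))) (restrict_space borel \<Xi>)"
    using assms(2) by (auto simp: space_restrict_space)
  then have "emeasure (dirac_sum \<Xi> I w a) A =
      emeasure (point_measure I (\<lambda>i. ennreal (w i))) (a -` A \<inter> I)"
    using assms(3) by (simp add: dirac_sum_def emeasure_distr space_point_measure)
  also have "\<dots> = (\<Sum>i\<in>a -` A \<inter> I. ennreal (w i))"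
    using assms(1) by (subst emeasure_point_measure_finite) auto
  also have "\<dots> = (\<Sum>i\<in>I. ennreal (w i) * indicator A (a i))"
    using assms(1) by (intro sum.mono_neutral_cong_left) (auto simp: indicator_def)
  finally show ?thesis
    using assms(3) by simp
qed

definition empirical_measure ::
  "(real^'k) set \<Rightarrow> nat \<Rightarrow> (nat \<Rightarrow> real^'k) \<Rightarrow> (real^'k) measure" where
  "empirical_measure \<Xi> N \<zeta> = dirac_sum \<Xi> {1..N} (\<lambda>_. 1 / real N) \<zeta>"

definition ambiguity_set ::
  "ereal \<Rightarrow> real \<Rightarrow> (real^'k) set \<Rightarrow> nat \<Rightarrow> (nat \<Rightarrow> real^'k) \<Rightarrow> real \<Rightarrow> (real^'k) measure set" where
  "ambiguity_set p r \<Xi> N \<zeta> \<epsilon> =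
     {Q \<in> prob_moment p r \<Xi>. wasserstein p r Q (empirical_measure \<Xi> N \<zeta>) \<le> ennreal \<epsilon>}"

(* In the following definitions Z stands for the function \<xi> \<mapsto> Z(x,\<xi>). *)

definition worst_case_expectation ::
  "(real^'k \<Rightarrow> real) \<Rightarrow> (real^'k) measure set \<Rightarrow> ereal" where
  "worst_case_expectation Z A = (SUP P\<in>A. ereal (\<integral>\<xi>. Z \<xi> \<partial>P))"

definition lagrange_dual ::
  "ereal \<Rightarrow> (real^'k \<Rightarrow> real) \<Rightarrow> (real^'k) set \<Rightarrow> nat \<Rightarrow> (nat \<Rightarrow> real^'k) \<Rightarrow> real \<Rightarrow> real \<Rightarrow> ereal" where
  "lagrange_dual p Z \<Xi> N \<zeta> \<epsilon> lam =
     ereal (\<epsilon>\<^sup>2 * lam) +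
     ereal (1 / real N) *
       (\<Sum>i\<in>{1..N}. SUP \<xi>\<in>\<Xi>. ereal (Z \<xi> - lam * (lp_norm p (\<xi> - \<zeta> i))\<^sup>2))"

definition optimal_multiplier ::
  "ereal \<Rightarrow> (real^'k \<Rightarrow> real) \<Rightarrow> (real^'k) set \<Rightarrow> nat \<Rightarrow> (nat \<Rightarrow> real^'k) \<Rightarrow> real \<Rightarrow> real \<Rightarrow> bool" where
  "optimal_multiplier p Z \<Xi> N \<zeta> \<epsilon> lam \<longleftrightarrow>
     is_arg_min (lagrange_dual p Z \<Xi> N \<zeta> \<epsilon>) (\<lambda>l. 0 \<le> l) lam"

(* The set of maximizers Pi*_{i,x,lam} is obtained for h = T x + \<zeta> i. *)
definition dual_argmax :: "ereal \<Rightarrow> (real^'k) set \<Rightarrow> real^'k \<Rightarrow> real \<Rightarrow> (real^'k) set" where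
  "dual_argmax q Pi_d h lam =
     {\<pi>. is_arg_max (\<lambda>\<pi>. \<pi> \<bullet> h + 1 / (4 * lam) * (lp_norm q \<pi>)\<^sup>2) (\<lambda>\<pi>. \<pi> \<in> Pi_d) \<pi>}"

definition weight_support :: "'a set \<Rightarrow> ('a \<Rightarrow> real) \<Rightarrow> 'a set" where
  "weight_support S m = {s\<in>S. m s \<noteq> 0}"

definition convex_weights :: "'a set \<Rightarrow> ('a \<Rightarrow> real) \<Rightarrow> bool" where
  "convex_weights S m \<longleftrightarrow>
     (\<forall>s\<in>S. 0 \<le> m s) \<and> finite (weight_support S m) \<and> (\<Sum>s\<in>weight_support S m. m s) = 1"

(* S i plays the role of Pi*_{i,x,lam}. *)
definition balanced_weights ::
  "ereal \<Rightarrow> nat \<Rightarrow> real \<Rightarrow> real \<Rightarrow> (nat \<Rightarrow> (real^'k) set) \<Rightarrow> (nat \<Rightarrow> real^'k \<Rightarrow> real) \<Rightarrow> bool" where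
  "balanced_weights q N \<epsilon> lam S \<mu> \<longleftrightarrow>
     (\<forall>i\<in>{1..N}. convex_weights (S i) (\<mu> i)) \<and>
     1 / real N *
       (\<Sum>i\<in>{1..N}. \<Sum>\<pi>\<in>weight_support (S i) (\<mu> i). \<mu> i \<pi> * ((lp_norm q \<pi>)\<^sup>2 / (4 * lam\<^sup>2))) = \<epsilon>\<^sup>2"

definition worst_case_distribution ::
  "ereal \<Rightarrow> (real^'k) set \<Rightarrow> nat \<Rightarrow> (nat \<Rightarrow> real^'k) \<Rightarrow> real \<Rightarrow> (nat \<Rightarrow> (real^'k) set) \<Rightarrow>
   (nat \<Rightarrow> real^'k \<Rightarrow> real) \<Rightarrow> (real^'k) measure" where
  "worst_case_distribution q \<Xi> N \<zeta> lam S \<mu> =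
     dirac_sum \<Xi> (SIGMA i:{1..N}. weight_support (S i) (\<mu> i))
       (\<lambda>(i, \<pi>). 1 / real N * \<mu> i \<pi>)
       (\<lambda>(i, \<pi>). \<zeta> i + (lp_norm q \<pi> / (2 * lam)) *\<^sub>R dual_direction q \<pi>)"

end

theory Submission
  imports Defs
begin

text \<open>
By conic duality the second-stage cost is a maximum of affine functions,
$Z(x,\xi) = \max_{\pi \in \Pi} \pi \cdot (T x + \xi)$, over the compact set $\Pi$ of dual feasible points
(\<open>second_stage_cost_attained\<close>, \<open>compact_dual_feasible\<close>). For a multiplier $l > 0$ put
$F_l(z) = \max_{\pi \in \Pi} (\pi \cdot (T x + z) + \|\pi\|_q^2 / (4 l))$. Hoelder's inequality and completing the
square give
$Z(x,\xi) \le F_l(z) + l \|\xi - z\|^2$ for all $\xi$ and $z$ (\<open>cost_le_penalized_cost\<close>). For a maximizer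
$\pi$ in $F_l(z)$ this is an equation at $\xi = z + \|\pi\|_q / (2 l) \cdot d_\pi$, since $d_\pi$ is the unit
vector that is tight in Hoelder's inequality and the step length makes the square vanish
(\<open>cost_at_shifted_point\<close>). The step is in a nonnegative direction, so it does not leave $\Xi$. Hence
the inner supremum of the Lagrangian at the sample $\zeta^i$ is $F_l(\zeta^i)$ (\<open>lagrange_dual_eq\<close>).

Integrating the inequality against a nearly optimal coupling of $P$ and the empirical distribution bounds
the expected cost under any $P$ in the ambiguity set by the Lagrangian at $l$
(\<open>expectation_le_lagrangian\<close>). The distribution in question is concentrated on points where the
inequality is tight, and moving each sample to its share of these points costs exactly the left-hand side
of the balance condition. With balanced weights the distribution is therefore admissible, and its expected cost equals the bound
(\<open>worst_case_distribution_optimal\<close>).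

It remains to see that balanced weights exist, which is where optimality of the multiplier enters. As a
function of $t = 1/(4 l)$, each $F_l(\zeta^i)$ is a maximum of affine functions with slopes $\|\pi\|_q^2$, so
its one-sided derivatives are the smallest and the largest slope among the maximizers. Stationarity of
the Lagrangian says that $\epsilon^2$ lies between the averages of $\|\pi\|_q^2 / (4 l^2)$ for these two
choices (\<open>stationary_multiplier_bounds\<close>), and a mixture of the two attains it
(\<open>balanced_weights_exist\<close>). The optimal multiplier is positive because $\Pi$, having an interior point,
contains a nonzero nonnegative vector, along which the cost is unbounded (\<open>lagrange_dual_at_zero\<close>).
\<close>

section \<open>Conjugate norms and the dual direction\<close>

lemma conjugate_exponents_cases:
  fixes p q :: ereal
  assumes "1 \<le> p" "1 \<le> q" "1 / p + 1 / q = 1"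
  obtains (inf_one) "p = \<infinity>" "q = 1"
  | (one_inf) "p = 1" "q = \<infinity>"
  | (finite) a b where "p = ereal a" "q = ereal b" "1 < a" "1 < b" "1 / a + 1 / b = 1"
proof (cases p)
  case (real a)
  show ?thesis
  proof (cases q)
    case q: (real b)
    have a: "1 \<le> a" and b: "1 \<le> b" using assms real q by (simp_all add: one_ereal_def)
    have "1 / a + 1 / b = 1"
      using assms(3) real q a b by (simp add: one_ereal_def)
    moreover from this have "a \<noteq> 1" "b \<noteq> 1"
      using a b by (auto simp: field_simps)
    ultimately show ?thesis using finite real q a b by simp
  next
    case PInf
    then have "1 / p = 1" using assms(3) by simp
    then have "a = 1" using real assms(1)
      by (auto simp: one_ereal_def divide_simps split: if_splits)
    then show ?thesis using one_inf real PInf by (simp add: one_ereal_def)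
  next
    case MInf
    then show ?thesis using assms by simp
  qed
next
  case PInf
  then have "1 / q = 1" using assms(3) by simp
  then have "q = 1"
    using assms(2) by (cases q) (auto simp: one_ereal_def divide_simps split: if_splits)
  then show ?thesis using inf_one PInf by simp
next
  case MInf
  then show ?thesis using assms by simp
qed

lemma lp_norm_real:
  "lp_norm (ereal a) v = (\<Sum>j\<in>UNIV. \<bar>v $ j\<bar> powr a) powr (1 / a)"
  by (simp add: lp_norm_def)

lemma lp_norm_inf: "lp_norm \<infinity> v = infnorm v"
  by (simp add: lp_norm_def)

lemma lp_norm_one: "lp_norm 1 v = (\<Sum>j\<in>UNIV. \<bar>v $ j\<bar>)"
  by (simp add: one_ereal_def lp_norm_real sum_nonneg)

lemma lp_norm_nonneg: "0 \<le> lp_norm p v"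
  by (simp add: lp_norm_def infnorm_pos_le)

lemma lp_norm_zero: "lp_norm p (0 :: real^'k) = 0"
  by (simp add: lp_norm_def infnorm_0)

lemma lp_norm_scale:
  assumes "1 \<le> p" "0 \<le> a"
  shows "lp_norm p (a *\<^sub>R v) = a * lp_norm p v"
proof (cases p)
  case (real r)
  then have r: "1 \<le> r" using assms by (simp add: one_ereal_def)
  have "(\<Sum>j\<in>UNIV. \<bar>(a *\<^sub>R v) $ j\<bar> powr r) = a powr r * (\<Sum>j\<in>UNIV. \<bar>v $ j\<bar> powr r)"
    using assms by (simp add: sum_distrib_left abs_mult powr_mult)
  then show ?thesis
    using assms r by (simp add: real lp_norm_real powr_mult sum_nonneg powr_powr)
next
  case PInf
  then show ?thesis using assms by (simp add: lp_norm_inf infnorm_mul)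
qed (use assms in auto)

lemma continuous_on_lp_norm [continuous_intros]:
  assumes "1 \<le> p" "continuous_on A f"
  shows "continuous_on A (\<lambda>x. lp_norm p (f x :: real^'k))"
proof (cases p)
  case (real r)
  then have r: "1 \<le> r" using assms by (simp add: one_ereal_def)
  show ?thesis
    unfolding real lp_norm_real using r assms(2)
    by (intro continuous_on_powr' continuous_intros) (auto simp: sum_nonneg)
next
  case PInf
  then show ?thesis using assms(2) by (simp add: lp_norm_inf continuous_intros)
qed (use assms in auto)

lemma lp_norm_measurable [measurable]:
  assumes "1 \<le> p"
  shows "lp_norm p \<in> borel_measurable (borel :: (real^'k) measure)"
  by (intro borel_measurable_continuous_onI continuous_on_lp_norm assms continuous_on_id)

text \<open>After scaling both vectors to norm one, Young's inequality in every coordinate sums to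
$1/a + 1/b = 1$.\<close>

lemma Hoelder_real:
  fixes v w :: "real^'k"
  assumes ab: "1 < a" "1 < b" "1 / a + 1 / b = 1"
  shows "(\<Sum>j\<in>UNIV. \<bar>v $ j\<bar> * \<bar>w $ j\<bar>) \<le> lp_norm (ereal a) v * lp_norm (ereal b) w"
proof -
  define A where "A = (\<Sum>j\<in>UNIV. \<bar>v $ j\<bar> powr a)"
  define B where "B = (\<Sum>j\<in>UNIV. \<bar>w $ j\<bar> powr b)"
  have A0: "0 \<le> A" and B0: "0 \<le> B" by (simp_all add: A_def B_def sum_nonneg)
  show ?thesis
  proof (cases "A = 0 \<or> B = 0")
    case True
    then have "(\<forall>j. v $ j = 0) \<or> (\<forall>j. w $ j = 0)"
      by (auto simp: A_def B_def sum_nonneg_eq_0_iff)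
    then show ?thesis
      by (auto simp: lp_norm_nonneg)
  next
    case False
    then have pos: "0 < A" "0 < B" using A0 B0 by auto
    define s where "s = A powr (1 / a)"
    define t where "t = B powr (1 / b)"
    have st: "0 < s" "0 < t" using pos by (simp_all add: s_def t_def)
    have sA: "s powr a = A" and tB: "t powr b = B"
      using ab pos by (simp_all add: s_def t_def powr_powr)
    have young: "\<bar>v $ j\<bar> / s * (\<bar>w $ j\<bar> / t) \<le> \<bar>v $ j\<bar> powr a / A / a + \<bar>w $ j\<bar> powr b / B / b" for j
      using Youngs_inequality[of a b "\<bar>v $ j\<bar> / s" "\<bar>w $ j\<bar> / t"] ab st
      by (simp add: powr_divide sA tB)
    have "(\<Sum>j\<in>UNIV. \<bar>v $ j\<bar> * \<bar>w $ j\<bar>) / (s * t) = (\<Sum>j\<in>UNIV. \<bar>v $ j\<bar> / s * (\<bar>w $ j\<bar> / t))"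
      by (simp add: sum_divide_distrib)
    also have "\<dots> \<le> (\<Sum>j\<in>UNIV. \<bar>v $ j\<bar> powr a / A / a + \<bar>w $ j\<bar> powr b / B / b)"
      by (intro sum_mono young)
    also have "\<dots> = A / A / a + B / B / b"
      unfolding sum.distrib A_def B_def sum_divide_distrib ..
    also have "\<dots> = 1" using pos ab by simp
    finally show ?thesis
      using st by (simp add: lp_norm_real s_def t_def A_def B_def divide_simps)
  qed
qed

lemma Hoelder_one_inf:
  fixes v w :: "real^'k"
  shows "(\<Sum>j\<in>UNIV. \<bar>v $ j\<bar> * \<bar>w $ j\<bar>) \<le> lp_norm 1 v * lp_norm \<infinity> w"
  unfolding lp_norm_one lp_norm_inf sum_distrib_right
  by (intro sum_mono mult_left_mono component_le_infnorm_cart) auto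

lemma Hoelder:
  fixes v w :: "real^'k"
  assumes "1 \<le> p" "1 \<le> q" "1 / p + 1 / q = 1"
  shows "\<bar>v \<bullet> w\<bar> \<le> lp_norm q v * lp_norm p w"
proof -
  have "\<bar>v \<bullet> w\<bar> \<le> (\<Sum>j\<in>UNIV. \<bar>v $ j * w $ j\<bar>)"
    unfolding inner_vec_def inner_real_def by (rule sum_abs)
  also have "\<dots> = (\<Sum>j\<in>UNIV. \<bar>v $ j\<bar> * \<bar>w $ j\<bar>)"
    by (simp add: abs_mult)
  also have "\<dots> \<le> lp_norm q v * lp_norm p w"
    using assms
  proof (cases rule: conjugate_exponents_cases)
    case inf_one
    then show ?thesis using Hoelder_one_inf[of v w] by simp
  next
    case one_inf
    then show ?thesis using Hoelder_one_inf[of w v] by (simp add: mult.commute)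
  next
    case (finite a b)
    then show ?thesis using Hoelder_real[of b a v w] by (simp add: add.commute)
  qed
  finally show ?thesis .
qed

lemma dual_direction_real:
  fixes \<pi> :: "real^'k"
  assumes ab: "1 < a" "1 < b" "1 / a + 1 / b = 1" and "0 \<le> \<pi>" "\<pi> \<noteq> 0"
  shows "lp_norm (ereal a) (dual_direction (ereal b) \<pi>) = 1"
    and "\<pi> \<bullet> dual_direction (ereal b) \<pi> = lp_norm (ereal b) \<pi>"
proof -
  define S where "S = (\<Sum>j\<in>UNIV. \<pi> $ j powr b)"
  define L where "L = lp_norm (ereal b) \<pi>"
  have nn: "0 \<le> \<pi> $ j" for j using assms by (simp add: less_eq_vec_def)
  obtain j where "\<pi> $ j \<noteq> 0" using assms by (auto simp: vec_eq_iff)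
  then have "S \<noteq> 0"
    using nn ab by (auto simp: S_def sum_nonneg_eq_0_iff)
  then have S: "0 < S" by (simp add: S_def sum_nonneg order_less_le)
  have LS: "L = S powr (1 / b)" using nn by (simp add: L_def lp_norm_real S_def)
  then have L: "0 < L" using S by simp
  have LbS: "L powr b = S" using S ab by (simp add: LS powr_powr)
  have d: "dual_direction (ereal b) \<pi> $ j = \<pi> $ j powr (b - 1) / L powr (b - 1)" for j
    using ab by (simp add: dual_direction_def rpow_def L_def)
  have e: "(b - 1) * a = b" using ab by (simp add: field_simps)
  have "(\<Sum>j\<in>UNIV. \<bar>dual_direction (ereal b) \<pi> $ j\<bar> powr a) = (\<Sum>j\<in>UNIV. \<pi> $ j powr b / S)"
    using L by (simp add: d powr_divide powr_powr e LbS)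
  also have "\<dots> = 1" using S by (simp add: S_def flip: sum_divide_distrib)
  finally show "lp_norm (ereal a) (dual_direction (ereal b) \<pi>) = 1"
    by (simp add: lp_norm_real)
  have m: "t * t powr (b - 1) = t powr b" if "0 \<le> t" for t
    using that ab by (cases "t = 0") (auto simp: powr_diff)
  have "\<pi> \<bullet> dual_direction (ereal b) \<pi> = S / L powr (b - 1)"
    by (simp add: inner_vec_def d m nn S_def sum_divide_distrib)
  also have "\<dots> = L" using L m[of L] by (simp add: LbS field_simps)
  finally show "\<pi> \<bullet> dual_direction (ereal b) \<pi> = lp_norm (ereal b) \<pi>" by (simp add: L_def)
qed

lemma dual_direction_one:
  fixes \<pi> :: "real^'k"
  assumes "0 \<le> \<pi>"
  shows "lp_norm \<infinity> (dual_direction 1 \<pi>) = 1"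
    and "\<pi> \<bullet> dual_direction 1 \<pi> = lp_norm 1 \<pi>"
proof -
  have d: "dual_direction 1 \<pi> = (\<chi> j. 1)"
    by (simp add: dual_direction_def rpow_def)
  have "{\<bar>(\<chi> j. (1 :: real)) $ i\<bar> |i :: 'k. i \<in> UNIV} = {1}" by auto
  then show "lp_norm \<infinity> (dual_direction 1 \<pi>) = 1"
    by (simp add: d lp_norm_inf infnorm_cart)
  show "\<pi> \<bullet> dual_direction 1 \<pi> = lp_norm 1 \<pi>"
    using assms by (simp add: d lp_norm_one inner_vec_def less_eq_vec_def)
qed

lemma dual_direction_inf:
  fixes \<pi> :: "real^'k"
  assumes "0 \<le> \<pi>"
  shows "lp_norm 1 (dual_direction \<infinity> \<pi>) = 1"
    and "\<pi> \<bullet> dual_direction \<infinity> \<pi> = lp_norm \<infinity> \<pi>"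
proof -
  define M where "M = {l. \<pi> $ l = infnorm \<pi>}"
  have d: "dual_direction \<infinity> \<pi> $ j = (if j \<in> M then 1 / real (card M) else 0)" for j
    by (simp add: dual_direction_def lp_norm_inf M_def)
  have "infnorm \<pi> \<in> (\<lambda>i. \<bar>\<pi> \<bullet> i\<bar>) ` Basis"
    unfolding infnorm_Max by (intro Max_in) auto
  then obtain j where "infnorm \<pi> = \<bar>\<pi> $ j\<bar>"
    by (auto simp: Basis_vec_def inner_axis)
  then have "j \<in> M" using assms by (simp add: M_def less_eq_vec_def)
  then have M: "0 < card M" by (metis card_gt_0_iff empty_iff finite)
  show "lp_norm 1 (dual_direction \<infinity> \<pi>) = 1"
    using M by (auto simp: lp_norm_one d if_distrib[of abs] sum.If_cases)
  have "\<pi> \<bullet> dual_direction \<infinity> \<pi> = (\<Sum>j\<in>UNIV. if j \<in> M then \<pi> $ j / real (card M) else 0)"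
    unfolding inner_vec_def by (intro sum.cong) (auto simp: d)
  also have "\<dots> = (\<Sum>j\<in>M. infnorm \<pi> / real (card M))"
    by (simp add: sum.If_cases) (simp add: M_def)
  finally show "\<pi> \<bullet> dual_direction \<infinity> \<pi> = lp_norm \<infinity> \<pi>"
    using M by (auto simp: lp_norm_inf)
qed

lemma dual_direction_nonneg:
  assumes "0 \<le> \<pi>"
  shows "0 \<le> dual_direction q \<pi>"
  by (simp add: dual_direction_def rpow_def less_eq_vec_def)

text \<open>The dual direction is a unit vector of the \<open>l\<^sub>p\<close>-norm at which Hoelder's inequality for \<open>\<pi>\<close>
is tight. Scaling by \<open>lp_norm q \<pi>\<close> covers \<open>\<pi> = 0\<close> as well, where \<open>dual_direction\<close> need not
be a unit vector.\<close>

lemma dual_direction_aligned: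
  fixes \<pi> :: "real^'k"
  assumes "1 \<le> p" "1 \<le> q" "1 / p + 1 / q = 1" "0 \<le> \<pi>"
  shows "lp_norm p (lp_norm q \<pi> *\<^sub>R dual_direction q \<pi>) = lp_norm q \<pi>"
    and "\<pi> \<bullet> (lp_norm q \<pi> *\<^sub>R dual_direction q \<pi>) = (lp_norm q \<pi>)\<^sup>2"
proof -
  have "lp_norm p (dual_direction q \<pi>) = 1 \<and> \<pi> \<bullet> dual_direction q \<pi> = lp_norm q \<pi>" if "\<pi> \<noteq> 0"
    using assms(1-3)
  proof (cases rule: conjugate_exponents_cases)
    case inf_one
    then show ?thesis using dual_direction_one assms by blast
  next
    case one_inf
    then show ?thesis using dual_direction_inf assms by blast
  next
    case (finite a b)
    then show ?thesis using dual_direction_real[of a b \<pi>] assms that by simp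
  qed
  then show "lp_norm p (lp_norm q \<pi> *\<^sub>R dual_direction q \<pi>) = lp_norm q \<pi>"
    and "\<pi> \<bullet> (lp_norm q \<pi> *\<^sub>R dual_direction q \<pi>) = (lp_norm q \<pi>)\<^sup>2"
    using assms
    by (cases "\<pi> = 0"; simp add: lp_norm_zero lp_norm_scale lp_norm_nonneg power2_eq_square)+
qed

section \<open>Conic duality for the second stage\<close>

text \<open>Both properties pass from the factors to the product because the projections onto the blocks
are linear.\<close>

lemma product_of_proper_cones_imp_cone:
  assumes "product_of_proper_cones K"
  shows "cone K" and "convex K"
proof -
  obtain P C where
    C: "\<And>B. B \<in> P \<Longrightarrow> cone (C B) \<and> convex (C B)" and
    K: "K = {y. \<forall>B\<in>P. coord_proj B y \<in> C B}"
    using assms by (auto simp: product_of_proper_cones_def proper_cone_in_def)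
  have proj: "coord_proj B (a *\<^sub>R y + b *\<^sub>R z) = a *\<^sub>R coord_proj B y + b *\<^sub>R coord_proj B z"
    for a b B and y z :: "real^'a"
    by (simp add: coord_proj_def vec_eq_iff)
  have projs: "coord_proj B (a *\<^sub>R y) = a *\<^sub>R coord_proj B y"
    for a B and y :: "real^'a"
    by (simp add: coord_proj_def vec_eq_iff)
  show "cone K" using C unfolding K cone_def by (simp add: projs)
  show "convex K" using C unfolding K convex_def by (simp add: proj)
qed

lemma inner_mono_vec:
  fixes u v w :: "real^'k"
  assumes "0 \<le> u" "v \<le> w"
  shows "u \<bullet> v \<le> u \<bullet> w"
  unfolding inner_vec_def inner_real_def
  using assms by (intro sum_mono mult_left_mono) (auto simp: less_eq_vec_def)

lemma dual_feasible_iff: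
  "\<pi> \<in> dual_feasible K c W \<longleftrightarrow> 0 \<le> \<pi> \<and> (\<forall>y\<in>K. \<pi> \<bullet> (W *v y) \<le> c \<bullet> y)"
  by (auto simp: dual_feasible_def dual_cone_def inner_diff_left dot_lmul_matrix
      transpose_matrix_vector)

lemma dual_feasibleD:
  assumes "\<pi> \<in> dual_feasible K c W"
  shows "0 \<le> \<pi>" and "\<And>y. y \<in> K \<Longrightarrow> \<pi> \<bullet> (W *v y) \<le> c \<bullet> y"
  using assms by (auto simp: dual_feasible_iff)

lemma weak_duality:
  assumes "\<pi> \<in> dual_feasible K c W" "y \<in> K" "h \<le> W *v y"
  shows "\<pi> \<bullet> h \<le> c \<bullet> y"
  using dual_feasibleD[OF assms(1)] inner_mono_vec[of \<pi> h "W *v y"] assms(2,3) by fastforce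

lemma closed_dual_feasible: "closed (dual_feasible K c (W :: real^'ny^'k))"
proof -
  have "dual_feasible K c W =
      (\<Inter>j. {\<pi>. 0 \<le> \<pi> $ j}) \<inter> (\<Inter>y\<in>K. {\<pi>. \<pi> \<bullet> (W *v y) \<le> c \<bullet> y})"
    by (auto simp: dual_feasible_iff less_eq_vec_def)
  also have "closed \<dots>"
    by (intro closed_Int closed_INT ballI closed_Collect_le continuous_intros)
  finally show ?thesis .
qed

text \<open>Complete recourse provides a \<open>y\<close> with \<open>W y\<close> above the vector of ones; testing a dual feasible
\<open>\<pi> \<ge> 0\<close> with this single \<open>y\<close> bounds its \<open>l\<^sub>1\<close>-norm by \<open>c \<bullet> y\<close>.\<close>

lemma compact_dual_feasible:
  fixes W :: "real^'ny^'k"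
  assumes "complete_recourse K W"
  shows "compact (dual_feasible K c W)"
proof -
  obtain y where y: "y \<in> K" "(\<chi> j. 1) \<le> W *v y"
    using assms by (auto simp: complete_recourse_def)
  have "norm \<pi> \<le> c \<bullet> y" if \<pi>: "\<pi> \<in> dual_feasible K c W" for \<pi>
  proof -
    have "norm \<pi> \<le> (\<Sum>j\<in>UNIV. \<bar>\<pi> $ j\<bar>)" by (rule norm_le_l1_cart)
    also have "\<dots> = \<pi> \<bullet> (\<chi> j. 1)"
      using dual_feasibleD(1)[OF \<pi>] by (simp add: inner_vec_def less_eq_vec_def)
    also have "\<dots> \<le> c \<bullet> y" using weak_duality[OF \<pi> y] .
    finally show ?thesis .
  qed
  then have "bounded (dual_feasible K c W)" by (auto simp: bounded_iff)
  then show ?thesis using closed_dual_feasible compact_eq_bounded_closed by blast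
qed

text \<open>If \<open>s\<close> lies strictly below the cost of every feasible point, then \<open>(h, s)\<close> lies outside the convex
cone of pairs of a right-hand side and a value that is at least the cost of some feasible point. A
hyperplane that separates the two is not vertical, since by complete recourse every right-hand side occurs in the
cone; its normalized slope is dual feasible and has value at least \<open>s\<close> at \<open>h\<close>.\<close>

lemma strong_duality_approx:
  fixes W :: "real^'ny^'k"
  assumes cone: "cone K" and conv: "convex K" and recourse: "complete_recourse K W"
    and s: "\<And>y. y \<in> K \<Longrightarrow> h \<le> W *v y \<Longrightarrow> s < c \<bullet> y"
  shows "\<exists>\<pi>\<in>dual_feasible K c W. s \<le> \<pi> \<bullet> h"
proof -
  define D where "D = {(g, t). \<exists>y\<in>K. g \<le> W *v y \<and> c \<bullet> y \<le> t}"
  have DI: "(g, t) \<in> D" if "y \<in> K" "g \<le> W *v y" "c \<bullet> y \<le> t" for y g t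
    using that by (auto simp: D_def)
  have scaleD: "a *\<^sub>R z \<in> D" if z: "z \<in> D" and a: "0 \<le> a" for z and a :: real
  proof -
    obtain g t y where "z = (g, t)" "y \<in> K" "g \<le> W *v y" "c \<bullet> y \<le> t"
      using z by (auto simp: D_def)
    then show ?thesis
      using a cone
      by (auto intro!: DI[of "a *\<^sub>R y"] scaleR_left_mono mult_left_mono
          simp: cone_def matrix_vector_mult_scaleR)
  qed
  have addD: "z + z' \<in> D" if z: "z \<in> D" "z' \<in> D" for z z'
  proof -
    obtain g t y g' t' y' where "z = (g, t)" "y \<in> K" "g \<le> W *v y" "c \<bullet> y \<le> t"
      "z' = (g', t')" "y' \<in> K" "g' \<le> W *v y'" "c \<bullet> y' \<le> t'"
      using z by (auto simp: D_def)
    then show ?thesis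
      using convex_cone[of K] cone conv
      by (auto intro!: DI[of "y + y'"] add_mono simp: matrix_vector_right_distrib inner_add_right)
  qed
  have D: "convex D" "cone D"
    using scaleD addD by (auto simp: convex_def cone_def)
  have zD: "(h, s) \<notin> D" using s by (fastforce simp: D_def)
  obtain y0 where y0: "y0 \<in> K" using recourse by (auto simp: complete_recourse_def)
  then have K0: "0 \<in> K" using cone unfolding cone_def by (metis order_refl scaleR_zero_left)
  then have D0: "(0, 0) \<in> D" by (auto intro: DI[of 0])
  obtain a b where a: "a \<noteq> 0" "\<forall>z\<in>{(h, s)}. a \<bullet> z \<le> b" "\<forall>z\<in>D. b \<le> a \<bullet> z"
    using separating_hyperplane_sets[of "{(h, s)}" D] D(1) zD D0 by blast
  obtain u \<beta> where ub: "a = (u, \<beta>)" by (cases a)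
  have b0: "b \<le> 0" using a(3) D0 by (auto simp: ub)
  \<comment> \<open>A linear functional that is bounded below on a cone is nonnegative there.\<close>
  have pos: "0 \<le> a \<bullet> z" if z: "z \<in> D" for z
  proof (rule ccontr)
    assume neg: "\<not> 0 \<le> a \<bullet> z"
    define r where "r = (b - 1) / (a \<bullet> z)"
    have "0 \<le> r" using neg b0 by (simp add: r_def divide_nonpos_nonpos)
    then have "b \<le> a \<bullet> (r *\<^sub>R z)" using a(3) scaleD[OF z] by blast
    also have "\<dots> = b - 1" using neg by (simp add: r_def)
    finally show False by simp
  qed
  have \<beta>0: "0 \<le> \<beta>" using pos[of "(0, 1)"] DI[OF K0, of 0 1] by (simp add: ub)
  \<comment> \<open>With slope zero the functional would be nonnegative at all right-hand sides, hence zero.\<close>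
  have "\<beta> \<noteq> 0"
  proof
    assume "\<beta> = 0"
    have "0 \<le> u \<bullet> g" for g
    proof -
      obtain y where "y \<in> K" "g \<le> W *v y" using recourse by (auto simp: complete_recourse_def)
      then show ?thesis using pos[OF DI[of y g "c \<bullet> y"]] \<open>\<beta> = 0\<close> by (simp add: ub)
    qed
    from this[of "- u"] have "u \<bullet> u = 0" using inner_ge_zero[of u] by simp
    then have "u = 0" by simp
    then show False using a(1) \<open>\<beta> = 0\<close> by (simp add: ub zero_prod_def)
  qed
  then have \<beta>: "0 < \<beta>" using \<beta>0 by simp
  define \<pi> where "\<pi> = - (u /\<^sub>R \<beta>)"
  have le: "\<pi> \<bullet> g \<le> t" if "(g, t) \<in> D" for g t
    using pos[OF that] \<beta> by (simp add: ub \<pi>_def field_simps)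
  have "0 \<le> \<pi> $ j" for j
  proof -
    have "- axis j 1 \<le> (0 :: real^'k)" by (simp add: less_eq_vec_def axis_def)
    then show ?thesis
      using le[OF DI[OF K0, of "- axis j 1" 0]] by (simp add: inner_axis)
  qed
  moreover have "\<pi> \<bullet> (W *v y) \<le> c \<bullet> y" if "y \<in> K" for y
    using that by (intro le DI[of y]) auto
  ultimately have "\<pi> \<in> dual_feasible K c W"
    by (simp add: dual_feasible_iff less_eq_vec_def)
  moreover have "s \<le> \<pi> \<bullet> h"
    using a(2) b0 \<beta> by (simp add: ub \<pi>_def field_simps)
  ultimately show ?thesis by blast
qed

lemma second_stage_cost_ge:
  assumes "complete_recourse K W" "\<pi> \<in> dual_feasible K c W"
  shows "\<pi> \<bullet> (T *v x + \<xi>) \<le> second_stage_cost K c W T x \<xi>"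
  unfolding second_stage_cost_def
proof (rule cINF_greatest)
  show "{y \<in> K. T *v x + \<xi> \<le> W *v y} \<noteq> {}"
    using assms(1) by (auto simp: complete_recourse_def)
qed (auto intro: weak_duality[OF assms(2)])

text \<open>Approximate dual solutions and compactness of the dual feasible set give an exact one.\<close>

lemma second_stage_cost_attained:
  fixes W :: "real^'ny^'k"
  assumes "cone K" "convex K" and recourse: "complete_recourse K W"
    and ne: "dual_feasible K c W \<noteq> {}"
  shows "\<exists>\<pi>\<in>dual_feasible K c W. second_stage_cost K c W T x \<xi> = \<pi> \<bullet> (T *v x + \<xi>)"
proof -
  let ?h = "T *v x + \<xi>" and ?D = "dual_feasible K c W" and ?Z = "second_stage_cost K c W T x \<xi>"
  have "continuous_on ?D (\<lambda>\<pi>. \<pi> \<bullet> ?h)" by (intro continuous_intros)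
  then obtain \<pi> where \<pi>: "\<pi> \<in> ?D" "\<And>\<rho>. \<rho> \<in> ?D \<Longrightarrow> \<rho> \<bullet> ?h \<le> \<pi> \<bullet> ?h"
    using continuous_attains_sup[OF compact_dual_feasible[OF recourse] ne] by blast
  obtain \<pi>0 where \<pi>0: "\<pi>0 \<in> ?D" using ne by blast
  have bdd: "bdd_below ((\<lambda>y. c \<bullet> y) ` {y \<in> K. ?h \<le> W *v y})"
    using weak_duality[OF \<pi>0] by (intro bdd_belowI2[where m = "\<pi>0 \<bullet> ?h"]) auto
  have "?Z \<le> \<pi> \<bullet> ?h"
  proof (rule dense_le)
    fix s assume s: "s < ?Z"
    have "\<exists>\<rho>\<in>?D. s \<le> \<rho> \<bullet> ?h"
    proof (rule strong_duality_approx[OF assms(1-3)])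
      fix y assume "y \<in> K" "?h \<le> W *v y"
      then have "?Z \<le> c \<bullet> y"
        unfolding second_stage_cost_def using bdd by (intro cINF_lower) auto
      then show "s < c \<bullet> y" using s by simp
    qed
    then show "s \<le> \<pi> \<bullet> ?h" using \<pi>(2) by force
  qed
  then show ?thesis
    using \<pi>(1) second_stage_cost_ge[OF recourse \<pi>(1), of T x \<xi>] by force
qed

section \<open>Maximizers of a linearly perturbed objective\<close>

text \<open>The dual objective at a sample point is \<open>u + t * v\<close>, where \<open>u\<close> is linear, \<open>v\<close> is the squared dual norm
and \<open>t = 1 / (4 * l)\<close> for the multiplier \<open>l\<close>. How its maximum varies with \<open>t\<close> decides what
optimality of a multiplier means for the maximizers.\<close>

definition perturbed_argmax :: "'a set \<Rightarrow> ('a \<Rightarrow> real) \<Rightarrow> ('a \<Rightarrow> real) \<Rightarrow> real \<Rightarrow> 'a set" where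
  "perturbed_argmax S u v t = {\<pi>. is_arg_max (\<lambda>\<pi>. u \<pi> + t * v \<pi>) (\<lambda>\<pi>. \<pi> \<in> S) \<pi>}"

definition perturbed_max :: "'a set \<Rightarrow> ('a \<Rightarrow> real) \<Rightarrow> ('a \<Rightarrow> real) \<Rightarrow> real \<Rightarrow> real" where
  "perturbed_max S u v t = (SUP \<pi>\<in>S. u \<pi> + t * v \<pi>)"

lemma perturbed_argmax_iff:
  "\<pi> \<in> perturbed_argmax S u v t \<longleftrightarrow>
    \<pi> \<in> S \<and> (\<forall>\<rho>\<in>S. u \<rho> + t * v \<rho> \<le> u \<pi> + t * v \<pi>)"
  by (auto simp: perturbed_argmax_def is_arg_max_linorder)

lemma perturbed_argmax_uminus:
  "perturbed_argmax S u (\<lambda>\<pi>. - v \<pi>) (- t) = perturbed_argmax S u v t"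
  by (simp add: perturbed_argmax_def)

lemma perturbed_argmax_nonempty:
  fixes S :: "'a::topological_space set"
  assumes "compact S" "S \<noteq> {}" "continuous_on S u" "continuous_on S v"
  shows "perturbed_argmax S u v t \<noteq> {}"
proof -
  have "continuous_on S (\<lambda>\<pi>. u \<pi> + t * v \<pi>)" by (intro continuous_intros assms)
  from continuous_attains_sup[OF assms(1,2) this] show ?thesis
    using perturbed_argmax_iff[of _ S u v t] by blast
qed

lemma perturbed_max_eq:
  assumes "\<pi> \<in> perturbed_argmax S u v t"
  shows "perturbed_max S u v t = u \<pi> + t * v \<pi>"
  using assms unfolding perturbed_max_def perturbed_argmax_iff
  by (intro cSup_eq_maximum) auto

lemma perturbed_max_ge:
  fixes S :: "'a::topological_space set"
  assumes "compact S" "continuous_on S u" "continuous_on S v" "\<pi> \<in> S"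
  shows "u \<pi> + t * v \<pi> \<le> perturbed_max S u v t"
proof -
  obtain \<rho> where "\<rho> \<in> perturbed_argmax S u v t"
    using perturbed_argmax_nonempty[OF assms(1) _ assms(2,3)] assms(4) by blast
  then show ?thesis
    using assms(4) perturbed_max_eq[of \<rho> S u v t] by (auto simp: perturbed_argmax_iff)
qed

lemma compact_perturbed_argmax:
  fixes S :: "'a::t2_space set"
  assumes "compact S" "continuous_on S u" "continuous_on S v"
  shows "compact (perturbed_argmax S u v t)"
proof -
  have "\<pi> \<in> perturbed_argmax S u v t \<longleftrightarrow> \<pi> \<in> S \<and> perturbed_max S u v t \<le> u \<pi> + t * v \<pi>" for \<pi>
  proof
    assume \<pi>: "\<pi> \<in> perturbed_argmax S u v t"
    then show "\<pi> \<in> S \<and> perturbed_max S u v t \<le> u \<pi> + t * v \<pi>"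
      using perturbed_max_eq[OF \<pi>] by (simp add: perturbed_argmax_iff)
  next
    assume "\<pi> \<in> S \<and> perturbed_max S u v t \<le> u \<pi> + t * v \<pi>"
    then show "\<pi> \<in> perturbed_argmax S u v t"
      unfolding perturbed_argmax_iff by (meson perturbed_max_ge[OF assms] order_trans)
  qed
  then have "perturbed_argmax S u v t = S \<inter> {\<pi>\<in>S. perturbed_max S u v t \<le> u \<pi> + t * v \<pi>}"
    by blast
  also have "compact \<dots>"
    using assms
    by (intro compact_Int_closed continuous_on_closed_Collect_le continuous_intros
        compact_imp_closed) auto
  finally show ?thesis .
qed

text \<open>This is upper semicontinuity of the set of maximizers, seen through \<open>v\<close>. On the compact set where
\<open>m \<le> v\<close> the objective at \<open>s\<close> stays below its maximum by a fixed gap, and because \<open>v\<close> is bounded this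
gap survives small changes of \<open>s\<close>.\<close>

lemma perturbed_argmax_near:
  fixes S :: "'a::t2_space set"
  assumes S: "compact S" and u: "continuous_on S u" and v: "continuous_on S v"
    and m: "\<And>\<pi>. \<pi> \<in> perturbed_argmax S u v s \<Longrightarrow> v \<pi> < m"
  shows "\<forall>\<^sub>F t in nhds s. \<forall>\<pi>\<in>perturbed_argmax S u v t. v \<pi> < m"
proof -
  define C where "C = S \<inter> {\<pi>\<in>S. m \<le> v \<pi>}"
  have C: "compact C"
    unfolding C_def using S v
    by (intro compact_Int_closed continuous_on_closed_Collect_le continuous_intros
        compact_imp_closed) auto
  show ?thesis
  proof (cases "C = {}")
    case True
    then show ?thesis by (intro always_eventually) (force simp: C_def perturbed_argmax_iff)
  next
    case False
    have "continuous_on C (\<lambda>\<pi>. u \<pi> + s * v \<pi>)"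
      using u v by (intro continuous_intros) (auto intro: continuous_on_subset simp: C_def)
    then obtain \<rho> where \<rho>: "\<rho> \<in> C" "\<And>\<pi>. \<pi> \<in> C \<Longrightarrow> u \<pi> + s * v \<pi> \<le> u \<rho> + s * v \<rho>"
      using continuous_attains_sup[OF C False] by blast
    have "\<rho> \<notin> perturbed_argmax S u v s" using m[of \<rho>] \<rho>(1) by (auto simp: C_def)
    then obtain \<sigma> where \<sigma>: "\<sigma> \<in> S" "u \<rho> + s * v \<rho> < u \<sigma> + s * v \<sigma>"
      using \<rho>(1) by (auto simp: C_def perturbed_argmax_iff not_le)
    define g where "g = (u \<sigma> + s * v \<sigma>) - (u \<rho> + s * v \<rho>)"
    have "bounded (v ` S)" using S v by (intro compact_imp_bounded compact_continuous_image)
    then obtain B where B: "0 < B" "\<And>\<pi>. \<pi> \<in> S \<Longrightarrow> \<bar>v \<pi>\<bar> \<le> B"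
      by (auto simp: bounded_pos)
    have "v \<pi> < m" if t: "dist t s < g / (2 * B)" and \<pi>: "\<pi> \<in> perturbed_argmax S u v t" for t \<pi>
    proof (rule ccontr)
      assume "\<not> v \<pi> < m"
      then have "\<pi> \<in> C" using \<pi> by (auto simp: C_def perturbed_argmax_iff)
      have drift: "\<bar>(t - s) * v \<tau>\<bar> < g / 2" if "\<tau> \<in> S" for \<tau>
      proof -
        have "\<bar>(t - s) * v \<tau>\<bar> \<le> \<bar>t - s\<bar> * B"
          using B(2)[OF that] by (simp add: abs_mult mult_left_mono)
        also have "\<dots> < g / 2" using t B(1) by (simp add: dist_real_def field_simps)
        finally show ?thesis .
      qed
      have "u \<sigma> + t * v \<sigma> \<le> u \<pi> + t * v \<pi>"
        using \<pi> \<sigma>(1) by (simp add: perturbed_argmax_iff)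
      moreover have "u \<pi> + s * v \<pi> \<le> u \<rho> + s * v \<rho>" using \<rho>(2)[OF \<open>\<pi> \<in> C\<close>] .
      moreover have "\<bar>(t - s) * v \<sigma>\<bar> < g / 2" "\<bar>(t - s) * v \<pi>\<bar> < g / 2"
        using drift \<sigma>(1) \<pi> by (auto simp: perturbed_argmax_iff)
      ultimately show False
        unfolding left_diff_distrib g_def by argo
    qed
    moreover have "0 < g / (2 * B)" using \<sigma> B by (simp add: g_def)
    ultimately show ?thesis unfolding eventually_nhds_metric by blast
  qed
qed

text \<open>A maximizer at \<open>t\<close> is still a candidate at \<open>s\<close>: its \<open>v\<close>-value is a subgradient at \<open>t\<close> of the convex
function \<open>perturbed_max\<close> of the parameter.\<close>

lemma perturbed_max_diff_le:
  fixes S :: "'a::topological_space set"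
  assumes "compact S" "continuous_on S u" "continuous_on S v"
    and "\<pi> \<in> perturbed_argmax S u v t"
  shows "perturbed_max S u v t - perturbed_max S u v s \<le> (t - s) * v \<pi>"
proof -
  have "u \<pi> + s * v \<pi> \<le> perturbed_max S u v s"
    using assms by (intro perturbed_max_ge) (auto simp: perturbed_argmax_iff)
  then show ?thesis
    using perturbed_max_eq[OF assms(4)] by (simp add: algebra_simps)
qed

text \<open>This is the first-order condition at the minimizer \<open>l\<close>, in the form that Danskin's theorem gives it:
the one-sided derivatives in \<open>t\<close> of each maximum are the extreme values of \<open>v\<close> over the maximizers, and
\<open>1 / (4 * k)\<close> has derivative \<open>- 1 / (4 * k\<^sup>2)\<close>. Instead of differentiating, the proof compares
\<open>l\<close> with nearby multipliers \<open>k\<close> through the subgradient inequality and lets \<open>k\<close> tend to \<open>l\<close>: from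
below for the first bound, from above for the second.\<close>

lemma stationary_multiplier_bounds:
  fixes S :: "'a::t2_space set" and u :: "'i \<Rightarrow> 'a \<Rightarrow> real"
  assumes S: "compact S" "S \<noteq> {}" and I: "finite I"
    and u: "\<And>i. i \<in> I \<Longrightarrow> continuous_on S (u i)" and v: "continuous_on S v" and l: "0 < l"
    and min: "\<And>k. 0 < k \<Longrightarrow>
      e * l + (\<Sum>i\<in>I. perturbed_max S (u i) v (1 / (4 * l))) \<le>
      e * k + (\<Sum>i\<in>I. perturbed_max S (u i) v (1 / (4 * k)))"
  shows "(\<And>i \<pi>. i \<in> I \<Longrightarrow> \<pi> \<in> perturbed_argmax S (u i) v (1 / (4 * l)) \<Longrightarrow> v \<pi> \<le> M i)
      \<Longrightarrow> 4 * l\<^sup>2 * e \<le> (\<Sum>i\<in>I. M i)"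
    and "(\<And>i \<pi>. i \<in> I \<Longrightarrow> \<pi> \<in> perturbed_argmax S (u i) v (1 / (4 * l)) \<Longrightarrow> M i \<le> v \<pi>)
      \<Longrightarrow> (\<Sum>i\<in>I. M i) \<le> 4 * l\<^sup>2 * e"
proof -
  let ?s = "\<lambda>k. 1 / (4 * k)"
  obtain P where P: "\<And>i k. i \<in> I \<Longrightarrow> P i k \<in> perturbed_argmax S (u i) v (?s k)"
  proof
    fix i k assume "i \<in> I"
    then show "(SOME \<pi>. \<pi> \<in> perturbed_argmax S (u i) v (?s k)) \<in> perturbed_argmax S (u i) v (?s k)"
      using perturbed_argmax_nonempty[OF S u v] by (simp add: some_in_eq)
  qed
  have lim: "((\<lambda>k. ?s k) \<longlongrightarrow> ?s l) (at l)"
    using l by (intro tendsto_intros) auto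
  have step: "e * (l - k) \<le> (?s k - ?s l) * (\<Sum>i\<in>I. v (P i k))" if k: "0 < k" for k
  proof -
    have "e * (l - k) \<le> (\<Sum>i\<in>I. perturbed_max S (u i) v (?s k) - perturbed_max S (u i) v (?s l))"
      using min[OF k] by (simp add: sum_subtractf algebra_simps)
    also have "\<dots> \<le> (\<Sum>i\<in>I. (?s k - ?s l) * v (P i k))"
      using S u v P by (intro sum_mono perturbed_max_diff_le) auto
    finally show ?thesis by (simp add: sum_distrib_left)
  qed
  \<comment> \<open>Cancelling $l - k$ leaves an upper or a lower bound on the sum, according to its sign.\<close>
  have step': "(l - k) * (4 * k * l * e) \<le> (l - k) * (\<Sum>i\<in>I. v (P i k))" if k: "0 < k" for k
  proof -
    have kl: "0 < 4 * k * l" using k l by simp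
    have "?s k - ?s l = (l - k) / (4 * k * l)" using k l by (simp add: field_simps)
    then have "e * (l - k) \<le> (l - k) * (\<Sum>i\<in>I. v (P i k)) / (4 * k * l)"
      using step[OF k] by simp
    then have "e * (l - k) * (4 * k * l) \<le> (l - k) * (\<Sum>i\<in>I. v (P i k))"
      unfolding pos_le_divide_eq[OF kl] .
    then show ?thesis by (simp only: mult.commute mult.left_commute)
  qed
  have pos: "\<forall>\<^sub>F k in at l within A. 0 < k" for A
    using order_tendstoD(1)[OF tendsto_ident_at l, of A] by simp
  have loc: "\<forall>\<^sub>F k in at l within A. \<forall>i\<in>I. Q i (P i k)"
    if Q: "\<And>i. i \<in> I \<Longrightarrow> \<forall>\<^sub>F t in nhds (?s l). \<forall>\<pi>\<in>perturbed_argmax S (u i) v t. Q i \<pi>" for A Q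
  proof -
    have "\<forall>\<^sub>F k in at l within A. \<forall>\<pi>\<in>perturbed_argmax S (u i) v (?s k). Q i \<pi>" if "i \<in> I" for i
      using eventually_compose_filterlim[OF Q[OF that] tendsto_within_subset[OF lim, of A]] by simp
    then have "\<forall>\<^sub>F k in at l within A. \<forall>i\<in>I. \<forall>\<pi>\<in>perturbed_argmax S (u i) v (?s k). Q i \<pi>"
      using I by (simp add: eventually_ball_finite)
    then show ?thesis by eventually_elim (use P in blast)
  qed
  have lim4: "((\<lambda>k. 4 * k * l * e) \<longlongrightarrow> 4 * l\<^sup>2 * e) (at l within A)" for A
    by (auto intro!: tendsto_eq_intros simp: power2_eq_square)
  show "4 * l\<^sup>2 * e \<le> (\<Sum>i\<in>I. M i)"
    if M: "\<And>i \<pi>. i \<in> I \<Longrightarrow> \<pi> \<in> perturbed_argmax S (u i) v (?s l) \<Longrightarrow> v \<pi> \<le> M i"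
  proof (rule field_le_epsilon)
    fix \<delta> :: real assume \<delta>: "0 < \<delta>"
    define d where "d = \<delta> / (real (card I) + 1)"
    have d: "0 < d" "card I * d \<le> \<delta>" using \<delta> by (auto simp: d_def field_simps)
    have near: "\<forall>\<^sub>F t in nhds (?s l). \<forall>\<pi>\<in>perturbed_argmax S (u i) v t. v \<pi> < M i + d" if i: "i \<in> I" for i
    proof (rule perturbed_argmax_near[OF S(1) u[OF i] v])
      show "v \<pi> < M i + d" if "\<pi> \<in> perturbed_argmax S (u i) v (?s l)" for \<pi>
        using M[OF i that] d(1) by simp
    qed
    have "\<forall>\<^sub>F k in at_left l. \<forall>i\<in>I. v (P i k) < M i + d"
      using near by (rule loc)
    moreover have "\<forall>\<^sub>F k in at_left l. k < l" by (simp add: eventually_at_left_field) (use lt_ex in blast)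
    ultimately have "\<forall>\<^sub>F k in at_left l. 4 * k * l * e \<le> (\<Sum>i\<in>I. M i) + \<delta>"
      using pos[of "{..<l}"]
    proof eventually_elim
      case (elim k)
      have "4 * k * l * e \<le> (\<Sum>i\<in>I. v (P i k))"
        using step'[of k] elim by (simp add: mult_le_cancel_left_pos)
      also have "\<dots> \<le> (\<Sum>i\<in>I. M i + d)"
        using elim by (intro sum_mono) force
      also have "\<dots> \<le> (\<Sum>i\<in>I. M i) + \<delta>" using d(2) by (simp add: sum.distrib)
      finally show ?case .
    qed
    then show "4 * l\<^sup>2 * e \<le> (\<Sum>i\<in>I. M i) + \<delta>"
      by (intro tendsto_upperbound[OF lim4]) auto
  qed
  show "(\<Sum>i\<in>I. M i) \<le> 4 * l\<^sup>2 * e"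
    if M: "\<And>i \<pi>. i \<in> I \<Longrightarrow> \<pi> \<in> perturbed_argmax S (u i) v (?s l) \<Longrightarrow> M i \<le> v \<pi>"
  proof (rule field_le_epsilon)
    fix \<delta> :: real assume \<delta>: "0 < \<delta>"
    define d where "d = \<delta> / (real (card I) + 1)"
    have d: "0 < d" "card I * d \<le> \<delta>" using \<delta> by (auto simp: d_def field_simps)
    have near: "\<forall>\<^sub>F t in nhds (?s l). \<forall>\<pi>\<in>perturbed_argmax S (u i) v t. M i - d < v \<pi>" if i: "i \<in> I" for i
    proof -
      \<comment> \<open>The lower bound is the upper bound for $-v$ and the parameter $-t$.\<close>
      have "- v \<pi> < d - M i" if "\<pi> \<in> perturbed_argmax S (u i) (\<lambda>\<pi>. - v \<pi>) (- ?s l)" for \<pi>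
        using M[OF i, of \<pi>] that d(1) unfolding perturbed_argmax_uminus by simp
      then have "\<forall>\<^sub>F t in nhds (- ?s l). \<forall>\<pi>\<in>perturbed_argmax S (u i) (\<lambda>\<pi>. - v \<pi>) t. - v \<pi> < d - M i"
        by (rule perturbed_argmax_near[OF S(1) u[OF i] continuous_on_minus[OF v]])
      moreover have "filterlim uminus (nhds (- ?s l)) (nhds (?s l))"
        by (intro tendsto_intros filterlim_ident)
      ultimately have "\<forall>\<^sub>F t in nhds (?s l).
          \<forall>\<pi>\<in>perturbed_argmax S (u i) (\<lambda>\<pi>. - v \<pi>) (- t). - v \<pi> < d - M i"
        unfolding filterlim_iff by blast
      then show ?thesis
        unfolding perturbed_argmax_uminus by eventually_elim force
    qed
    have "\<forall>\<^sub>F k in at_right l. \<forall>i\<in>I. M i - d < v (P i k)"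
      using near by (rule loc)
    moreover have "\<forall>\<^sub>F k in at_right l. l < k" by (rule eventually_at_right_less)
    ultimately have "\<forall>\<^sub>F k in at_right l. (\<Sum>i\<in>I. M i) - \<delta> \<le> 4 * k * l * e"
      using pos[of "{l<..}"]
    proof eventually_elim
      case (elim k)
      have *: "(\<Sum>i\<in>I. v (P i k)) \<le> 4 * k * l * e"
        using step'[of k] elim by (simp add: mult_le_cancel_left_neg)
      have "(\<Sum>i\<in>I. M i) - \<delta> \<le> (\<Sum>i\<in>I. M i - d)" using d(2) by (simp add: sum_subtractf)
      also have "\<dots> \<le> (\<Sum>i\<in>I. v (P i k))"
        using elim by (intro sum_mono) force
      finally show ?case using * by simp
    qed
    then have "(\<Sum>i\<in>I. M i) - \<delta> \<le> 4 * l\<^sup>2 * e"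
      by (intro tendsto_lowerbound[OF lim4]) auto
    then show "(\<Sum>i\<in>I. M i) \<le> 4 * l\<^sup>2 * e + \<delta>" by simp
  qed
qed

section \<open>Balanced weights\<close>

definition two_point_weights :: "real \<Rightarrow> 'a \<Rightarrow> 'a \<Rightarrow> 'a \<Rightarrow> real" where
  "two_point_weights \<theta> a b \<pi> = (1 - \<theta>) * of_bool (\<pi> = a) + \<theta> * of_bool (\<pi> = b)"

lemma two_point_weights:
  assumes "a \<in> S" "b \<in> S" "0 \<le> \<theta>" "\<theta> \<le> 1"
  shows "convex_weights S (two_point_weights \<theta> a b)"
    and "(\<Sum>\<pi>\<in>weight_support S (two_point_weights \<theta> a b). two_point_weights \<theta> a b \<pi> * f \<pi>) =
      (1 - \<theta>) * f a + \<theta> * f b"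
proof -
  let ?w = "two_point_weights \<theta> a b"
  have sub: "weight_support S ?w \<subseteq> {a, b}"
    by (auto simp: weight_support_def two_point_weights_def)
  have sum: "(\<Sum>\<pi>\<in>weight_support S ?w. ?w \<pi> * g \<pi>) = (1 - \<theta>) * g a + \<theta> * g b" for g
  proof -
    have "(\<Sum>\<pi>\<in>weight_support S ?w. ?w \<pi> * g \<pi>) = (\<Sum>\<pi>\<in>{a, b}. ?w \<pi> * g \<pi>)"
      using sub assms by (intro sum.mono_neutral_left) (auto simp: weight_support_def)
    also have "\<dots> = (1 - \<theta>) * g a + \<theta> * g b"
      by (cases "a = b") (auto simp: two_point_weights_def algebra_simps)
    finally show ?thesis .
  qed
  show "(\<Sum>\<pi>\<in>weight_support S ?w. ?w \<pi> * f \<pi>) = (1 - \<theta>) * f a + \<theta> * f b" by (rule sum)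
  show "convex_weights S ?w"
    using assms sum[of "\<lambda>_. 1"] finite_subset[OF sub]
    by (auto simp: convex_weights_def two_point_weights_def)
qed

lemma convex_combination_between:
  fixes A B C :: real
  assumes "A \<le> C" "C \<le> B"
  obtains \<theta> where "0 \<le> \<theta>" "\<theta> \<le> 1" "(1 - \<theta>) * A + \<theta> * B = C"
proof -
  have "C \<in> closed_segment A B" using assms by (simp add: closed_segment_eq_real_ivl)
  then show ?thesis using that by (auto simp: closed_segment_def)
qed

text \<open>By \<open>stationary_multiplier_bounds\<close> the required total of \<open>v\<close> lies between the totals for a maximizer with
smallest and one with largest norm at each sample point. Mixing these two maximizers in the
same proportion at all sample points attains it.\<close>

lemma balanced_weights_exist:
  fixes S :: "(real^'k) set" and u :: "nat \<Rightarrow> real^'k \<Rightarrow> real"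
  assumes S: "compact S" "S \<noteq> {}" and q: "1 \<le> q" and N: "1 \<le> N"
    and u: "\<And>i. continuous_on S (u i)" and l: "0 < l"
    and min: "\<And>k. 0 < k \<Longrightarrow>
      \<epsilon>\<^sup>2 * l + 1 / real N * (\<Sum>i\<in>{1..N}. perturbed_max S (u i) (\<lambda>\<pi>. (lp_norm q \<pi>)\<^sup>2) (1 / (4 * l))) \<le>
      \<epsilon>\<^sup>2 * k + 1 / real N * (\<Sum>i\<in>{1..N}. perturbed_max S (u i) (\<lambda>\<pi>. (lp_norm q \<pi>)\<^sup>2) (1 / (4 * k)))"
  shows "\<exists>\<mu>. balanced_weights q N \<epsilon> l
    (\<lambda>i. perturbed_argmax S (u i) (\<lambda>\<pi>. (lp_norm q \<pi>)\<^sup>2) (1 / (4 * l))) \<mu>"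
proof -
  let ?v = "\<lambda>\<pi> :: real^'k. (lp_norm q \<pi>)\<^sup>2"
  let ?A = "\<lambda>i. perturbed_argmax S (u i) ?v (1 / (4 * l))"
  have v: "continuous_on S ?v" by (intro continuous_intros q)
  have A: "compact (?A i)" "?A i \<noteq> {}" for i
    using compact_perturbed_argmax[OF S(1) u v] perturbed_argmax_nonempty[OF S u v] by blast+
  have vA: "continuous_on (?A i) ?v" for i
    using v by (rule continuous_on_subset) (auto simp: perturbed_argmax_iff)
  have "\<exists>\<pi>\<in>?A i. \<forall>\<rho>\<in>?A i. ?v \<pi> \<le> ?v \<rho>" for i
    by (rule continuous_attains_inf[OF A vA])
  then obtain a where a: "\<And>i. a i \<in> ?A i" "\<And>i \<pi>. \<pi> \<in> ?A i \<Longrightarrow> ?v (a i) \<le> ?v \<pi>"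
    by metis
  have "\<exists>\<pi>\<in>?A i. \<forall>\<rho>\<in>?A i. ?v \<rho> \<le> ?v \<pi>" for i
    by (rule continuous_attains_sup[OF A vA])
  then obtain b where b: "\<And>i. b i \<in> ?A i" "\<And>i \<pi>. \<pi> \<in> ?A i \<Longrightarrow> ?v \<pi> \<le> ?v (b i)"
    by metis
  have min': "real N * \<epsilon>\<^sup>2 * l + (\<Sum>i\<in>{1..N}. perturbed_max S (u i) ?v (1 / (4 * l))) \<le>
      real N * \<epsilon>\<^sup>2 * k + (\<Sum>i\<in>{1..N}. perturbed_max S (u i) ?v (1 / (4 * k)))" if "0 < k" for k
    using mult_left_mono[OF min[OF that], of "real N"] N by (simp add: distrib_left mult.assoc)
  note bounds = stationary_multiplier_bounds[OF S finite_atLeastAtMost u v l min']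
  have "(\<Sum>i\<in>{1..N}. ?v (a i)) \<le> 4 * l\<^sup>2 * (real N * \<epsilon>\<^sup>2)"
    using a(2) by (intro bounds(2)) auto
  moreover have "4 * l\<^sup>2 * (real N * \<epsilon>\<^sup>2) \<le> (\<Sum>i\<in>{1..N}. ?v (b i))"
    using b(2) by (intro bounds(1)) auto
  ultimately obtain \<theta> where \<theta>: "0 \<le> \<theta>" "\<theta> \<le> 1"
    "(1 - \<theta>) * (\<Sum>i\<in>{1..N}. ?v (a i)) + \<theta> * (\<Sum>i\<in>{1..N}. ?v (b i)) = 4 * l\<^sup>2 * (real N * \<epsilon>\<^sup>2)"
    by (rule convex_combination_between)
  define \<mu> where "\<mu> i = two_point_weights \<theta> (a i) (b i)" for i
  have "(\<Sum>i\<in>{1..N}. \<Sum>\<pi>\<in>weight_support (?A i) (\<mu> i). \<mu> i \<pi> * (?v \<pi> / (4 * l\<^sup>2))) =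
      (\<Sum>i\<in>{1..N}. (1 - \<theta>) * (?v (a i) / (4 * l\<^sup>2)) + \<theta> * (?v (b i) / (4 * l\<^sup>2)))"
    unfolding \<mu>_def using a b \<theta> by (intro sum.cong two_point_weights) auto
  also have "\<dots> = ((1 - \<theta>) * (\<Sum>i\<in>{1..N}. ?v (a i)) + \<theta> * (\<Sum>i\<in>{1..N}. ?v (b i))) / (4 * l\<^sup>2)"
    by (simp add: sum.distrib sum_distrib_left sum_divide_distrib add_divide_distrib)
  also have "\<dots> = real N * \<epsilon>\<^sup>2" using l by (simp only: \<theta>(3)) simp
  finally have "balanced_weights q N \<epsilon> l ?A \<mu>"
    using N a b \<theta> unfolding balanced_weights_def
    by (auto simp: \<mu>_def intro: two_point_weights)
  then show ?thesis by blast
qed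

section \<open>Finitely supported measures\<close>

lemma dirac_sum_measurable [measurable]:
  assumes "a ` I \<subseteq> \<Xi>"
  shows "a \<in> measurable (point_measure I w) (restrict_space borel \<Xi>)"
  using assms by (auto simp: space_restrict_space)

lemma sets_dirac_sum: "sets (dirac_sum \<Xi> I w a) = sets (restrict_space borel \<Xi>)"
  by (simp add: dirac_sum_def)

lemma space_dirac_sum: "space (dirac_sum \<Xi> I w a) = \<Xi>"
  by (simp add: dirac_sum_def space_restrict_space)

lemma prob_space_dirac_sum:
  assumes "finite I" "a ` I \<subseteq> \<Xi>" "\<And>i. i \<in> I \<Longrightarrow> 0 \<le> w i" "(\<Sum>i\<in>I. w i) = 1"
  shows "prob_space (dirac_sum \<Xi> I w a)"
  unfolding dirac_sum_def
  using assms
  by (intro prob_space.prob_space_distr prob_space_point_measure dirac_sum_measurable)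
    (auto simp: sum_ennreal)

lemma integrable_dirac_sum:
  fixes f :: "'a::topological_space \<Rightarrow> real"
  assumes "finite I" "a ` I \<subseteq> \<Xi>" "f \<in> borel_measurable borel"
  shows "integrable (dirac_sum \<Xi> I w a) f"
  unfolding dirac_sum_def
  using assms
  by (subst integrable_distr_eq)
    (auto intro!: integrable_point_measure_finite measurable_restrict_space1
      simp: space_restrict_space)

lemma integral_dirac_sum:
  fixes f :: "'a::topological_space \<Rightarrow> real"
  assumes "finite I" "a ` I \<subseteq> \<Xi>" "\<And>i. i \<in> I \<Longrightarrow> 0 \<le> w i" "f \<in> borel_measurable borel"
  shows "(\<integral>\<xi>. f \<xi> \<partial>dirac_sum \<Xi> I w a) = (\<Sum>i\<in>I. w i * f (a i))"
  unfolding dirac_sum_def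
  using assms
  by (subst integral_distr)
    (auto intro!: measurable_restrict_space1
      simp: space_restrict_space lebesgue_integral_point_measure_finite)

text \<open>Atoms at equal positions may be merged by adding their weights. This identifies the second marginal
of the coupling below with the empirical distribution.\<close>

lemma dirac_sum_reindex:
  assumes "finite I" "finite J" "b ` J \<subseteq> \<Xi>" "f ` I \<subseteq> J" "\<And>i. i \<in> I \<Longrightarrow> 0 \<le> w i"
    and "\<And>j. j \<in> J \<Longrightarrow> (\<Sum>i\<in>{i\<in>I. f i = j}. w i) = w' j"
  shows "dirac_sum \<Xi> I w (b \<circ> f) = dirac_sum \<Xi> J w' b"
proof (rule measure_eqI)
  fix A assume "A \<in> sets (dirac_sum \<Xi> I w (b \<circ> f))"
  then have A: "A \<in> sets (restrict_space borel \<Xi>)" by (simp add: sets_dirac_sum)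
  let ?r = "\<lambda>j. emeasure (return (restrict_space borel \<Xi>) (b j)) A"
  have "emeasure (dirac_sum \<Xi> I w (b \<circ> f)) A = (\<Sum>i\<in>I. ennreal (w i) * ?r (f i))"
    using assms A by (subst emeasure_dirac_sum) auto
  also have "\<dots> = (\<Sum>j\<in>J. \<Sum>i\<in>{i\<in>I. f i = j}. ennreal (w i) * ?r (f i))"
    using assms by (intro sum.group[symmetric]) auto
  also have "\<dots> = (\<Sum>j\<in>J. ennreal (w' j) * ?r j)"
  proof (rule sum.cong[OF refl])
    fix j assume j: "j \<in> J"
    have "(\<Sum>i\<in>{i\<in>I. f i = j}. ennreal (w i) * ?r (f i)) =
        (\<Sum>i\<in>{i\<in>I. f i = j}. ennreal (w i)) * ?r j"
      unfolding sum_distrib_right by (intro sum.cong) auto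
    also have "(\<Sum>i\<in>{i\<in>I. f i = j}. ennreal (w i)) = ennreal (w' j)"
      using assms(5,6) j by (subst sum_ennreal) auto
    finally show "(\<Sum>i\<in>{i\<in>I. f i = j}. ennreal (w i) * ?r (f i)) = ennreal (w' j) * ?r j" .
  qed
  also have "\<dots> = emeasure (dirac_sum \<Xi> J w' b) A"
    using assms A by (subst emeasure_dirac_sum) auto
  finally show "emeasure (dirac_sum \<Xi> I w (b \<circ> f)) A = emeasure (dirac_sum \<Xi> J w' b) A" .
qed (simp add: sets_dirac_sum)

section \<open>Wasserstein distance\<close>

text \<open>The factors live on the trace of the Borel sets on \<open>\<Xi>\<close>; the costs are Borel functions on the
whole space, which needs the projections as maps into that space.\<close>

lemma measurable_projections_of_coupling:
  fixes P Q :: "(real^'k) measure"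
  assumes "sets P = sets (restrict_space borel \<Xi>)" "sets Q = sets (restrict_space borel \<Xi>)"
    and "sets \<gamma> = sets (P \<Otimes>\<^sub>M Q)"
  shows "fst \<in> borel_measurable \<gamma>" "snd \<in> borel_measurable \<gamma>"
proof -
  have "fst \<in> measurable \<gamma> P" "snd \<in> measurable \<gamma> Q"
    using measurable_fst[of P Q] measurable_snd[of P Q] measurable_cong_sets[OF assms(3)[symmetric] refl]
    by blast+
  moreover have "id \<in> borel_measurable P" "id \<in> borel_measurable Q"
    using measurable_cong_sets[OF assms(1) refl, of borel] measurable_cong_sets[OF assms(2) refl, of borel]
      measurable_restrict_space1[OF measurable_id, of borel \<Xi>] by (auto simp: id_def)
  ultimately have "id \<circ> fst \<in> borel_measurable \<gamma>" "id \<circ> snd \<in> borel_measurable \<gamma>"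
    by (blast intro: measurable_comp)+
  then show "fst \<in> borel_measurable \<gamma>" "snd \<in> borel_measurable \<gamma>" by simp_all
qed

text \<open>Moving each atom \<open>b i\<close> to \<open>a i\<close> is a coupling; its cost bounds the distance.\<close>

lemma wasserstein_dirac_sum_le:
  fixes a b :: "'i \<Rightarrow> real^'k"
  assumes p: "1 \<le> p" and I: "finite I" and ab: "a ` I \<subseteq> \<Xi>" "b ` I \<subseteq> \<Xi>"
    and w: "\<And>i. i \<in> I \<Longrightarrow> 0 \<le> w i"
    and cost: "(\<Sum>i\<in>I. w i * (lp_norm p (a i - b i))\<^sup>2) \<le> \<epsilon>\<^sup>2" and \<epsilon>: "0 \<le> \<epsilon>"
  shows "wasserstein p 2 (dirac_sum \<Xi> I w a) (dirac_sum \<Xi> I w b) \<le> ennreal \<epsilon>"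
proof -
  let ?P = "dirac_sum \<Xi> I w a" and ?Q = "dirac_sum \<Xi> I w b"
  let ?M = "point_measure I (\<lambda>i. ennreal (w i))" and ?h = "\<lambda>i. (a i, b i)"
  define \<gamma> where "\<gamma> = distr ?M (?P \<Otimes>\<^sub>M ?Q) ?h"
  have meas: "?h \<in> measurable ?M (?P \<Otimes>\<^sub>M ?Q)"
    using ab by (auto simp: space_pair_measure space_dirac_sum)
  have "distr \<gamma> ?P fst = distr ?M ?P a"
    unfolding \<gamma>_def by (subst distr_distr[OF measurable_fst meas]) (simp add: comp_def)
  also have "\<dots> = ?P"
    unfolding dirac_sum_def by (intro distr_cong) simp_all
  finally have fst: "distr \<gamma> ?P fst = ?P" .
  have "distr \<gamma> ?Q snd = distr ?M ?Q b"
    unfolding \<gamma>_def by (subst distr_distr[OF measurable_snd meas]) (simp add: comp_def)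
  also have "\<dots> = ?Q"
    unfolding dirac_sum_def by (intro distr_cong) simp_all
  finally have coupling: "\<gamma> \<in> couplings ?P ?Q"
    using fst by (simp add: couplings_def \<gamma>_def)
  have sets: "sets \<gamma> = sets (?P \<Otimes>\<^sub>M ?Q)" by (simp add: \<gamma>_def)
  note [measurable] = measurable_projections_of_coupling[OF sets_dirac_sum sets_dirac_sum sets[unfolded \<gamma>_def]]
    lp_norm_measurable[OF p]
  have "(\<integral>\<^sup>+ z. ennreal (lp_norm p (fst z - snd z) powr 2) \<partial>\<gamma>) =
      (\<integral>\<^sup>+ i. ennreal ((lp_norm p (a i - b i))\<^sup>2) \<partial>?M)"
    unfolding \<gamma>_def by (subst nn_integral_distr[OF meas]) (measurable, simp add: lp_norm_nonneg)
  also have "\<dots> = (\<Sum>i\<in>I. ennreal ((lp_norm p (a i - b i))\<^sup>2) * ennreal (w i))"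
    using I by (simp add: nn_integral_point_measure_finite mult.commute)
  also have "\<dots> = ennreal (\<Sum>i\<in>I. w i * (lp_norm p (a i - b i))\<^sup>2)"
    using w by (subst sum_ennreal[symmetric]) (auto simp: ennreal_mult mult.commute)
  finally have int: "(\<integral>\<^sup>+ z. ennreal (lp_norm p (fst z - snd z) powr 2) \<partial>\<gamma>) =
      ennreal (\<Sum>i\<in>I. w i * (lp_norm p (a i - b i))\<^sup>2)" .
  have "wasserstein p 2 ?P ?Q \<le>
      ennreal_powr (ennreal (\<Sum>i\<in>I. w i * (lp_norm p (a i - b i))\<^sup>2)) (1 / 2)"
    unfolding wasserstein_def int[symmetric] using coupling by (rule INF_lower)
  also have "\<dots> \<le> ennreal \<epsilon>"
  proof -
    have "(\<Sum>i\<in>I. w i * (lp_norm p (a i - b i))\<^sup>2) powr (1 / 2) \<le> (\<epsilon>\<^sup>2) powr (1 / 2)"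
      using cost w by (intro powr_mono2 sum_nonneg) auto
    then show ?thesis
      using \<epsilon> w by (simp add: ennreal_powr_def sum_nonneg ennreal_leI powr_half_sqrt)
  qed
  finally show ?thesis .
qed

text \<open>The infimum over couplings is only approached, so the slack \<open>\<delta>\<close> remains until the bound on the
expectation has been derived.\<close>

lemma wasserstein_coupling_near:
  assumes "wasserstein p 2 P Q \<le> ennreal \<epsilon>" "0 \<le> \<epsilon>" "0 < \<delta>"
  obtains \<gamma> where "\<gamma> \<in> couplings P Q"
    "(\<integral>\<^sup>+ z. ennreal ((lp_norm p (fst z - snd z))\<^sup>2) \<partial>\<gamma>) \<le> ennreal ((\<epsilon> + \<delta>)\<^sup>2)"
proof -
  have "wasserstein p 2 P Q < ennreal (\<epsilon> + \<delta>)"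
    using assms by (auto intro: le_less_trans simp: ennreal_less_iff)
  then obtain \<gamma> where \<gamma>: "\<gamma> \<in> couplings P Q"
    "ennreal_powr (\<integral>\<^sup>+ z. ennreal (lp_norm p (fst z - snd z) powr 2) \<partial>\<gamma>) (1 / 2) < ennreal (\<epsilon> + \<delta>)"
    unfolding wasserstein_def INF_less_iff by blast
  define C where "C = (\<integral>\<^sup>+ z. ennreal ((lp_norm p (fst z - snd z))\<^sup>2) \<partial>\<gamma>)"
  have C: "ennreal_powr C (1 / 2) < ennreal (\<epsilon> + \<delta>)"
    using \<gamma>(2) by (simp add: C_def lp_norm_nonneg)
  then have fin: "C \<noteq> \<infinity>" by (auto simp: ennreal_powr_def)
  then have "sqrt (enn2real C) < \<epsilon> + \<delta>"
    using C by (simp add: ennreal_powr_def powr_half_sqrt ennreal_less_iff)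
  then have "enn2real C \<le> (\<epsilon> + \<delta>)\<^sup>2"
    by (metis enn2real_nonneg less_eq_real_def order_less_imp_le real_sqrt_ge_zero real_sqrt_pow2 power_mono)
  then have "C \<le> ennreal ((\<epsilon> + \<delta>)\<^sup>2)"
    using fin by (metis ennreal_enn2real ennreal_leI infinity_ennreal_def less_top)
  then show ?thesis using that \<gamma>(1) unfolding C_def by blast
qed

section \<open>The Lagrangian of a maximum of affine functions\<close>

text \<open>A maximum of affine functions with slopes in a bounded set is Lipschitz, with the bound on the
slopes as constant. This makes the costs measurable.\<close>

lemma continuous_on_max_affine:
  fixes f :: "'a::real_inner \<Rightarrow> real"
  assumes "bounded S"
    and ge: "\<And>h \<pi>. \<pi> \<in> S \<Longrightarrow> \<pi> \<bullet> h + w \<pi> \<le> f h"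
    and attained: "\<And>h. \<exists>\<pi>\<in>S. f h = \<pi> \<bullet> h + w \<pi>"
  shows "continuous_on UNIV f"
proof -
  obtain B where B: "0 < B" "\<And>\<pi>. \<pi> \<in> S \<Longrightarrow> norm \<pi> \<le> B"
    using assms(1) by (auto simp: bounded_pos)
  have le: "f g - f h \<le> B * norm (g - h)" for g h
  proof -
    obtain \<pi> where \<pi>: "\<pi> \<in> S" "f g = \<pi> \<bullet> g + w \<pi>" using attained by blast
    have "f g - f h \<le> \<pi> \<bullet> (g - h)"
      using \<pi>(2) ge[OF \<pi>(1), of h] by (simp add: inner_diff_right)
    also have "\<dots> \<le> norm \<pi> * norm (g - h)" by (rule norm_cauchy_schwarz)
    also have "\<dots> \<le> B * norm (g - h)" using B(2)[OF \<pi>(1)] by (simp add: mult_right_mono)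
    finally show ?thesis .
  qed
  have "B-lipschitz_on UNIV f"
  proof (rule lipschitz_onI)
    show "dist (f g) (f h) \<le> B * dist g h" for g h
      using le[of g h] le[of h g] by (simp add: dist_norm norm_minus_commute abs_le_iff)
  qed (use B in simp)
  then show ?thesis by (rule lipschitz_on_continuous_on)
qed

text \<open>After conic duality the second stage enters only through a compact set \<open>S\<close> of nonnegative slopes:
the cost of \<open>\<xi>\<close> is the maximum over \<open>S\<close> of \<open>\<pi> \<bullet> (b + \<xi>)\<close>, with \<open>b = T x\<close>.\<close>

locale max_affine_cost =
  fixes S :: "(real^'k) set" and b :: "real^'k" and Z :: "real^'k \<Rightarrow> real" and p q :: ereal
  assumes p: "1 \<le> p" and q: "1 \<le> q" and conjugate: "1 / p + 1 / q = 1"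
    and compact: "compact S" and nonempty: "S \<noteq> {}" and nonneg: "\<And>\<pi>. \<pi> \<in> S \<Longrightarrow> 0 \<le> \<pi>"
    and Z_ge: "\<And>\<pi> \<xi>. \<pi> \<in> S \<Longrightarrow> \<pi> \<bullet> (b + \<xi>) \<le> Z \<xi>"
    and Z_attained: "\<And>\<xi>. \<exists>\<pi>\<in>S. Z \<xi> = \<pi> \<bullet> (b + \<xi>)"
begin

text \<open>This is the inner supremum of the Lagrangian at the sample point \<open>z\<close>, in its dual form;
\<open>sup_lagrangian\<close> shows the equality.\<close>

definition penalized_cost :: "real \<Rightarrow> real^'k \<Rightarrow> real" where
  "penalized_cost l z = perturbed_max S (\<lambda>\<pi>. \<pi> \<bullet> (b + z)) (\<lambda>\<pi>. (lp_norm q \<pi>)\<^sup>2) (1 / (4 * l))"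

lemma dual_argmax_eq:
  "dual_argmax q S (b + z) l =
    perturbed_argmax S (\<lambda>\<pi>. \<pi> \<bullet> (b + z)) (\<lambda>\<pi>. (lp_norm q \<pi>)\<^sup>2) (1 / (4 * l))"
  by (simp add: dual_argmax_def perturbed_argmax_def)

lemma continuous_objective:
  "continuous_on S (\<lambda>\<pi>. \<pi> \<bullet> (b + z))" "continuous_on S (\<lambda>\<pi>. (lp_norm q \<pi>)\<^sup>2)"
  by (intro continuous_intros q)+

lemma penalized_cost_ge:
  "\<pi> \<in> S \<Longrightarrow> \<pi> \<bullet> (b + z) + (lp_norm q \<pi>)\<^sup>2 / (4 * l) \<le> penalized_cost l z"
  using perturbed_max_ge[OF compact continuous_objective, where t = "1 / (4 * l)"]
  by (simp add: penalized_cost_def)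

lemma penalized_cost_eq:
  "\<pi> \<in> dual_argmax q S (b + z) l \<Longrightarrow> penalized_cost l z = \<pi> \<bullet> (b + z) + (lp_norm q \<pi>)\<^sup>2 / (4 * l)"
  unfolding dual_argmax_eq penalized_cost_def by (drule perturbed_max_eq) simp

lemma dual_argmax_nonempty: "dual_argmax q S (b + z) l \<noteq> {}"
  unfolding dual_argmax_eq by (intro perturbed_argmax_nonempty compact nonempty continuous_objective)

lemma dual_argmax_subset: "dual_argmax q S h l \<subseteq> S"
  by (auto simp: dual_argmax_def is_arg_max_def)

lemma cost_measurable: "Z \<in> borel_measurable borel"
  using compact_imp_bounded[OF compact] Z_ge Z_attained
  by (intro borel_measurable_continuous_onI continuous_on_max_affine[of S "\<lambda>\<pi>. \<pi> \<bullet> b"])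
    (auto simp: inner_add_right add.commute)

lemma penalized_cost_measurable: "penalized_cost l \<in> borel_measurable borel"
proof (intro borel_measurable_continuous_onI continuous_on_max_affine)
  let ?w = "\<lambda>\<pi>. \<pi> \<bullet> b + (lp_norm q \<pi>)\<^sup>2 / (4 * l)"
  show "bounded S" using compact by (rule compact_imp_bounded)
  show "\<pi> \<bullet> z + ?w \<pi> \<le> penalized_cost l z" if "\<pi> \<in> S" for \<pi> z
    using penalized_cost_ge[OF that, of z l] by (simp add: inner_add_right)
  show "\<exists>\<pi>\<in>S. penalized_cost l z = \<pi> \<bullet> z + ?w \<pi>" for z
    using dual_argmax_nonempty[of z l] dual_argmax_subset[of "b + z" l] penalized_cost_eq[of _ z l]
    by (fastforce simp: inner_add_right)
qed

text \<open>Hoelder's inequality bounds the gain of moving from \<open>z\<close> to \<open>\<xi>\<close> at a fixed slope by the product of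
the norms, and completing the square splits this product into the penalty term and the quadratic
term of \<open>penalized_cost\<close>.\<close>

lemma cost_le_penalized_cost:
  assumes l: "0 < l"
  shows "Z \<xi> \<le> penalized_cost l z + l * (lp_norm p (\<xi> - z))\<^sup>2"
proof -
  obtain \<pi> where \<pi>: "\<pi> \<in> S" "Z \<xi> = \<pi> \<bullet> (b + \<xi>)" using Z_attained by blast
  let ?m = "lp_norm q \<pi>" and ?t = "lp_norm p (\<xi> - z)"
  have "Z \<xi> = \<pi> \<bullet> (b + z) + \<pi> \<bullet> (\<xi> - z)"
    by (simp add: \<pi>(2) inner_add_right inner_diff_right)
  also have "\<pi> \<bullet> (\<xi> - z) \<le> ?m * ?t"
    using Hoelder[OF p q conjugate, of \<pi> "\<xi> - z"] by simp
  also have "?m * ?t \<le> ?m\<^sup>2 / (4 * l) + l * ?t\<^sup>2"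
  proof -
    have "0 \<le> (?m - 2 * l * ?t)\<^sup>2 / (4 * l)" using l by simp
    also have "\<dots> = ?m\<^sup>2 / (4 * l) + l * ?t\<^sup>2 - ?m * ?t"
      using l by (simp add: field_simps power2_eq_square)
    finally show ?thesis by simp
  qed
  finally show ?thesis using penalized_cost_ge[OF \<pi>(1), of z l] by simp
qed

text \<open>The point at which both steps in the proof of \<open>cost_le_penalized_cost\<close> are tight for the slope
\<open>\<pi>\<close>: the direction makes Hoelder's inequality an equation and the length \<open>lp_norm q \<pi> / (2 * l)\<close>
makes the square vanish.\<close>

definition shifted_point :: "real \<Rightarrow> real^'k \<Rightarrow> real^'k \<Rightarrow> real^'k" where
  "shifted_point l z \<pi> = z + (lp_norm q \<pi> / (2 * l)) *\<^sub>R dual_direction q \<pi>"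

lemma shifted_point_eq:
  "shifted_point l z \<pi> = z + (1 / (2 * l)) *\<^sub>R (lp_norm q \<pi> *\<^sub>R dual_direction q \<pi>)"
  by (simp add: shifted_point_def)

lemma shifted_point_distance:
  assumes "0 < l" "\<pi> \<in> S"
  shows "lp_norm p (shifted_point l z \<pi> - z) = lp_norm q \<pi> / (2 * l)"
  using assms dual_direction_aligned(1)[OF p q conjugate nonneg]
  by (simp add: shifted_point_eq lp_norm_scale[OF p] del: scaleR_scaleR)

lemma shifted_point_ge:
  assumes "0 < l" "\<pi> \<in> S"
  shows "z \<le> shifted_point l z \<pi>"
  using assms dual_direction_nonneg[OF nonneg, of \<pi> q] lp_norm_nonneg[of q \<pi>]
  by (simp add: shifted_point_def less_eq_vec_def)

text \<open>The slope \<open>\<pi>\<close> alone already yields this value from below, and \<open>cost_le_penalized_cost\<close> bounds it from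
above.\<close>

lemma cost_at_shifted_point:
  assumes l: "0 < l" and \<pi>: "\<pi> \<in> dual_argmax q S (b + z) l"
  shows "Z (shifted_point l z \<pi>) = penalized_cost l z + (lp_norm q \<pi>)\<^sup>2 / (4 * l)"
proof (rule antisym)
  have S: "\<pi> \<in> S" using \<pi> dual_argmax_subset by blast
  have *: "l * (lp_norm q \<pi> / (2 * l))\<^sup>2 = (lp_norm q \<pi>)\<^sup>2 / (4 * l)"
    using l by (simp add: power2_eq_square)
  show "Z (shifted_point l z \<pi>) \<le> penalized_cost l z + (lp_norm q \<pi>)\<^sup>2 / (4 * l)"
    using cost_le_penalized_cost[OF l, of "shifted_point l z \<pi>" z]
    by (simp add: shifted_point_distance[OF l S] *)
  have "\<pi> \<bullet> shifted_point l z \<pi> = \<pi> \<bullet> z + (lp_norm q \<pi>)\<^sup>2 / (2 * l)"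
    using dual_direction_aligned(2)[OF p q conjugate nonneg[OF S]]
    by (simp add: shifted_point_eq inner_add_right del: scaleR_scaleR)
  then show "penalized_cost l z + (lp_norm q \<pi>)\<^sup>2 / (4 * l) \<le> Z (shifted_point l z \<pi>)"
    using Z_ge[OF S, of "shifted_point l z \<pi>"] penalized_cost_eq[OF \<pi>]
    by (simp add: inner_add_right)
qed

text \<open>The supremum is attained at the shifted point of any maximizer, which lies in \<open>\<Xi>\<close> because the
shift is nonnegative.\<close>

lemma sup_lagrangian:
  assumes l: "0 < l" and z: "z \<in> \<Xi>" and up: "\<And>\<xi>. z \<le> \<xi> \<Longrightarrow> \<xi> \<in> \<Xi>"
  shows "(SUP \<xi>\<in>\<Xi>. ereal (Z \<xi> - l * (lp_norm p (\<xi> - z))\<^sup>2)) = ereal (penalized_cost l z)"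
proof (rule SUP_eqI)
  show "ereal (Z \<xi> - l * (lp_norm p (\<xi> - z))\<^sup>2) \<le> ereal (penalized_cost l z)" for \<xi>
    using cost_le_penalized_cost[OF l, of \<xi> z] by simp
next
  fix y assume y: "\<And>\<xi>. \<xi> \<in> \<Xi> \<Longrightarrow> ereal (Z \<xi> - l * (lp_norm p (\<xi> - z))\<^sup>2) \<le> y"
  obtain \<pi> where \<pi>: "\<pi> \<in> dual_argmax q S (b + z) l" using dual_argmax_nonempty by blast
  then have S: "\<pi> \<in> S" using dual_argmax_subset by blast
  have "Z (shifted_point l z \<pi>) - l * (lp_norm p (shifted_point l z \<pi> - z))\<^sup>2 = penalized_cost l z"
    using l by (simp add: cost_at_shifted_point[OF l \<pi>] shifted_point_distance[OF l S] power2_eq_square)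
  then show "ereal (penalized_cost l z) \<le> y"
    using y[of "shifted_point l z \<pi>"] up[OF shifted_point_ge[OF l S]] by simp
qed

lemma lagrange_dual_eq:
  assumes "0 < l" "\<And>i. i \<in> {1..N} \<Longrightarrow> \<zeta> i \<in> \<Xi>" "\<And>\<xi> \<xi>'. \<xi> \<in> \<Xi> \<Longrightarrow> \<xi> \<le> \<xi>' \<Longrightarrow> \<xi>' \<in> \<Xi>"
  shows "lagrange_dual p Z \<Xi> N \<zeta> \<epsilon> l =
    ereal (\<epsilon>\<^sup>2 * l + 1 / real N * (\<Sum>i\<in>{1..N}. penalized_cost l (\<zeta> i)))"
proof -
  have "(\<Sum>i\<in>{1..N}. SUP \<xi>\<in>\<Xi>. ereal (Z \<xi> - l * (lp_norm p (\<xi> - \<zeta> i))\<^sup>2)) =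
      (\<Sum>i\<in>{1..N}. ereal (penalized_cost l (\<zeta> i)))"
    using assms(2,3) by (intro sum.cong sup_lagrangian[OF assms(1)]) blast+
  then show ?thesis by (simp add: lagrange_dual_def)
qed

text \<open>Along a nonzero slope \<open>\<pi> \<ge> 0\<close>, a direction in which \<open>\<Xi>\<close> is unbounded, the cost grows at least
like \<open>t * (\<pi> \<bullet> \<pi>)\<close>, and without a penalty nothing stops it.\<close>

lemma lagrange_dual_at_zero:
  assumes "1 \<le> N" "\<And>i. i \<in> {1..N} \<Longrightarrow> \<zeta> i \<in> \<Xi>"
    and up: "\<And>\<xi> \<xi>'. \<xi> \<in> \<Xi> \<Longrightarrow> \<xi> \<le> \<xi>' \<Longrightarrow> \<xi>' \<in> \<Xi>"
    and \<pi>: "\<pi> \<in> S" "\<pi> \<noteq> 0"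
  shows "lagrange_dual p Z \<Xi> N \<zeta> \<epsilon> 0 = \<infinity>"
proof -
  have "(SUP \<xi>\<in>\<Xi>. ereal (Z \<xi> - 0 * (lp_norm p (\<xi> - \<zeta> i))\<^sup>2)) = \<infinity>" if i: "i \<in> {1..N}" for i
  proof (rule SUP_PInfty)
    fix n :: nat
    define t where "t = \<bar>real n - \<pi> \<bullet> (b + \<zeta> i)\<bar> / (\<pi> \<bullet> \<pi>)"
    have "0 \<le> t" by (simp add: t_def)
    then have "\<zeta> i + t *\<^sub>R \<pi> \<in> \<Xi>"
      using nonneg[OF \<pi>(1)] by (intro up[OF assms(2)[OF i]]) (simp add: less_eq_vec_def)
    moreover have "real n \<le> Z (\<zeta> i + t *\<^sub>R \<pi>)"
    proof -
      have "t * (\<pi> \<bullet> \<pi>) = \<bar>real n - \<pi> \<bullet> (b + \<zeta> i)\<bar>" using \<pi>(2) by (simp add: t_def)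
      then show ?thesis
        using Z_ge[OF \<pi>(1), of "\<zeta> i + t *\<^sub>R \<pi>"] by (simp add: inner_add_right)
    qed
    ultimately show "\<exists>\<xi>\<in>\<Xi>. ereal (real n) \<le> ereal (Z \<xi> - 0 * (lp_norm p (\<xi> - \<zeta> i))\<^sup>2)"
      by auto
  qed
  then have "(\<Sum>i\<in>{1..N}. SUP \<xi>\<in>\<Xi>. ereal (Z \<xi> - 0 * (lp_norm p (\<xi> - \<zeta> i))\<^sup>2)) = \<infinity>"
    using assms(1) by (subst sum_Pinfty) auto
  then show ?thesis using assms(1) by (simp only: lagrange_dual_def) simp
qed

text \<open>The cost grows at most linearly, hence is dominated by a multiple of $2 + \|\xi\|^2$.\<close>

lemma cost_integrable:
  assumes "P \<in> prob_moment p 2 \<Xi>"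
  shows "integrable P Z"
proof -
  have P: "prob_space P" "sets P = sets (restrict_space borel \<Xi>)"
    and int: "integrable P (\<lambda>\<xi>. (lp_norm p \<xi>)\<^sup>2)"
    using assms by (auto simp: prob_moment_def lp_norm_nonneg)
  interpret prob_space P by (rule P)
  have "bounded ((\<lambda>\<pi>. \<bar>\<pi> \<bullet> b\<bar> + lp_norm q \<pi>) ` S)"
    using compact q
    by (intro compact_imp_bounded compact_continuous_image continuous_intros)
  then obtain B where "0 < B" and "\<forall>\<pi>\<in>S. \<bar>\<bar>\<pi> \<bullet> b\<bar> + lp_norm q \<pi>\<bar> \<le> B"
    by (auto simp: bounded_pos)
  then have B: "\<bar>\<pi> \<bullet> b\<bar> + lp_norm q \<pi> \<le> B" if "\<pi> \<in> S" for \<pi>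
    using that abs_le_D1 by blast
  have growth: "\<bar>Z \<xi>\<bar> \<le> B * (2 + (lp_norm p \<xi>)\<^sup>2)" for \<xi>
  proof -
    obtain \<pi> where \<pi>: "\<pi> \<in> S" "Z \<xi> = \<pi> \<bullet> (b + \<xi>)" using Z_attained by blast
    have B': "\<bar>\<pi> \<bullet> b\<bar> \<le> B" "lp_norm q \<pi> \<le> B"
      using B[OF \<pi>(1)] lp_norm_nonneg[of q \<pi>] by auto
    \<comment> \<open>For $t \<ge> 0$, expanding $0 \<le> (t - 1)^2$ gives $t \<le> 2 t \<le> 1 + t^2$.\<close>
    have "lp_norm p \<xi> \<le> 1 + (lp_norm p \<xi>)\<^sup>2"
      using zero_le_power2[of "lp_norm p \<xi> - 1"] lp_norm_nonneg[of p \<xi>]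
      by (simp add: power2_eq_square algebra_simps)
    then have "lp_norm q \<pi> * lp_norm p \<xi> \<le> B * (1 + (lp_norm p \<xi>)\<^sup>2)"
      using B'(2) lp_norm_nonneg \<open>0 < B\<close> by (intro mult_mono) auto
    then show ?thesis
      using Hoelder[OF p q conjugate, of \<pi> \<xi>] B'(1) by (simp add: \<pi>(2) inner_add_right distrib_left)
  qed
  show ?thesis
  proof (rule Bochner_Integration.integrable_bound)
    show "integrable P (\<lambda>\<xi>. B * (2 + (lp_norm p \<xi>)\<^sup>2))" using int by simp
    show "Z \<in> borel_measurable P"
      using measurable_restrict_space1[OF cost_measurable, of \<Xi>]
      by (simp add: measurable_cong_sets[OF P(2) refl])
    show "AE \<xi> in P. norm (Z \<xi>) \<le> norm (B * (2 + (lp_norm p \<xi>)\<^sup>2))"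
      using growth \<open>0 < B\<close> by (intro AE_I2) (auto intro: order_trans)
  qed
qed

text \<open>Weak duality: integrate \<open>cost_le_penalized_cost\<close> against a nearly optimal coupling of \<open>P\<close> and the
empirical distribution. The first term integrates to the average of \<open>penalized_cost\<close> over the
samples, the second to \<open>l\<close> times the transport cost.\<close>

lemma expectation_le_lagrangian:
  assumes P: "P \<in> ambiguity_set p 2 \<Xi> N \<zeta> \<epsilon>" and N: "1 \<le> N"
    and \<zeta>: "\<And>i. i \<in> {1..N} \<Longrightarrow> \<zeta> i \<in> \<Xi>" and \<epsilon>: "0 \<le> \<epsilon>" and l: "0 < l"
  shows "(\<integral>\<xi>. Z \<xi> \<partial>P) \<le> \<epsilon>\<^sup>2 * l + 1 / real N * (\<Sum>i\<in>{1..N}. penalized_cost l (\<zeta> i))"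
proof -
  let ?E = "empirical_measure \<Xi> N \<zeta>"
  let ?A = "1 / real N * (\<Sum>i\<in>{1..N}. penalized_cost l (\<zeta> i))"
  have Pm: "P \<in> prob_moment p 2 \<Xi>" and W: "wasserstein p 2 P ?E \<le> ennreal \<epsilon>"
    using P by (auto simp: ambiguity_set_def)
  have setsP: "sets P = sets (restrict_space borel \<Xi>)" using Pm by (simp add: prob_moment_def)
  have setsE: "sets ?E = sets (restrict_space borel \<Xi>)"
    by (simp add: empirical_measure_def sets_dirac_sum)
  have \<zeta>im: "\<zeta> ` {1..N} \<subseteq> \<Xi>" using \<zeta> by blast
  have bound: "(\<integral>\<xi>. Z \<xi> \<partial>P) \<le> ?A + l * (\<epsilon> + \<delta>)\<^sup>2" if \<delta>: "0 < \<delta>" for \<delta>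
  proof -
    obtain \<gamma> where \<gamma>: "\<gamma> \<in> couplings P ?E"
      and cost: "(\<integral>\<^sup>+ z. ennreal ((lp_norm p (fst z - snd z))\<^sup>2) \<partial>\<gamma>) \<le> ennreal ((\<epsilon> + \<delta>)\<^sup>2)"
      using wasserstein_coupling_near[OF W \<epsilon> \<delta>] .
    have sets: "sets \<gamma> = sets (P \<Otimes>\<^sub>M ?E)"
      and fst: "distr \<gamma> P fst = P" and snd: "distr \<gamma> ?E snd = ?E"
      using \<gamma> by (auto simp: couplings_def)
    have mf: "fst \<in> measurable \<gamma> P" and ms: "snd \<in> measurable \<gamma> ?E"
      using measurable_cong_sets[OF sets refl] by (auto simp: measurable_fst measurable_snd)
    note meas = measurable_projections_of_coupling[OF setsP setsE sets]
    have intZ: "integrable P Z" using Pm by (rule cost_integrable)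
    have intF: "integrable ?E (penalized_cost l)"
      unfolding empirical_measure_def
      using \<zeta>im penalized_cost_measurable by (intro integrable_dirac_sum) auto
    have i1: "integrable \<gamma> (\<lambda>z. Z (fst z))"
      using integrable_distr[OF mf, of Z] intZ fst by simp
    have i2: "integrable \<gamma> (\<lambda>z. penalized_cost l (snd z))"
      using integrable_distr[OF ms, of "penalized_cost l"] intF snd by simp
    let ?c = "\<lambda>z :: (real^'k) \<times> (real^'k). (lp_norm p (fst z - snd z))\<^sup>2"
    have mc: "?c \<in> borel_measurable \<gamma>"
    proof -
      have "(\<lambda>z. lp_norm p (fst z - snd z)) \<in> borel_measurable \<gamma>"
        using meas by (intro measurable_compose[OF _ lp_norm_measurable[OF p]] borel_measurable_diff)
      then show ?thesis by (rule borel_measurable_power)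
    qed
    have i3: "integrable \<gamma> ?c"
      using cost by (intro integrableI_nonneg[OF mc]) (auto intro: le_less_trans)
    have c3: "(\<integral>z. ?c z \<partial>\<gamma>) \<le> (\<epsilon> + \<delta>)\<^sup>2"
      using cost nn_integral_eq_integral[OF i3] by simp
    have "(\<integral>\<xi>. Z \<xi> \<partial>P) = (\<integral>z. Z (fst z) \<partial>\<gamma>)"
      using integral_distr[OF mf, of Z] intZ fst by simp
    also have "\<dots> \<le> (\<integral>z. penalized_cost l (snd z) + l * ?c z \<partial>\<gamma>)"
      using i1 i2 i3 cost_le_penalized_cost[OF l] by (intro integral_mono) auto
    also have "\<dots> = (\<integral>z. penalized_cost l (snd z) \<partial>\<gamma>) + l * (\<integral>z. ?c z \<partial>\<gamma>)"
      using i2 i3 by simp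
    also have "(\<integral>z. penalized_cost l (snd z) \<partial>\<gamma>) = (\<integral>z. penalized_cost l z \<partial>?E)"
      using integral_distr[OF ms, of "penalized_cost l"] intF snd by simp
    also have "\<dots> = ?A"
      unfolding empirical_measure_def using \<zeta>im penalized_cost_measurable
      by (subst integral_dirac_sum) (auto simp: sum_distrib_left)
    finally show ?thesis using mult_left_mono[OF c3, of l] l by linarith
  qed
  have "((\<lambda>\<delta>. ?A + l * (\<epsilon> + \<delta>)\<^sup>2) \<longlongrightarrow> ?A + l * (\<epsilon> + 0)\<^sup>2) (at_right 0)"
    by (intro tendsto_intros)
  moreover have "\<forall>\<^sub>F \<delta> in at_right 0. (\<integral>\<xi>. Z \<xi> \<partial>P) \<le> ?A + l * (\<epsilon> + \<delta>)\<^sup>2"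
    using eventually_at_right_less[of 0] by eventually_elim (rule bound)
  ultimately have "(\<integral>\<xi>. Z \<xi> \<partial>P) \<le> ?A + l * (\<epsilon> + 0)\<^sup>2"
    by (rule tendsto_lowerbound) simp
  then show ?thesis by (simp add: mult.commute)
qed

section \<open>The worst-case distribution\<close>

text \<open>Moving each sample to the shifted points of its maximizers makes every inequality of
\<open>expectation_le_lagrangian\<close> tight. The transport cost is the average of the squared lengths
\<open>(lp_norm q \<pi> / (2 * l))\<^sup>2\<close>, which the balanced weights set to \<open>\<epsilon>\<^sup>2\<close>; the budget is used up
exactly, and the expected cost equals the Lagrangian.\<close>

lemma worst_case_distribution_optimal:
  assumes N: "1 \<le> N" and \<zeta>: "\<And>i. i \<in> {1..N} \<Longrightarrow> \<zeta> i \<in> \<Xi>"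
    and up: "\<And>\<xi> \<xi>'. \<xi> \<in> \<Xi> \<Longrightarrow> \<xi> \<le> \<xi>' \<Longrightarrow> \<xi>' \<in> \<Xi>"
    and \<epsilon>: "0 \<le> \<epsilon>" and l: "0 < l"
    and \<mu>: "balanced_weights q N \<epsilon> l (\<lambda>i. dual_argmax q S (b + \<zeta> i) l) \<mu>"
  defines "Q \<equiv> worst_case_distribution q \<Xi> N \<zeta> l (\<lambda>i. dual_argmax q S (b + \<zeta> i) l) \<mu>"
  shows "Q \<in> ambiguity_set p 2 \<Xi> N \<zeta> \<epsilon>"
    and "(\<integral>\<xi>. Z \<xi> \<partial>Q) = \<epsilon>\<^sup>2 * l + 1 / real N * (\<Sum>i\<in>{1..N}. penalized_cost l (\<zeta> i))"
proof -
  let ?A = "\<lambda>i. dual_argmax q S (b + \<zeta> i) l"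
  define U where "U i = weight_support (?A i) (\<mu> i)" for i
  define I where "I = (SIGMA i:{1..N}. U i)"
  define w where "w = (\<lambda>(i, \<pi>). 1 / real N * \<mu> i \<pi>)"
  define a where "a = (\<lambda>(i, \<pi>). shifted_point l (\<zeta> i) \<pi>)"
  have Q: "Q = dirac_sum \<Xi> I w a"
    unfolding Q_def worst_case_distribution_def I_def U_def w_def a_def shifted_point_def ..
  have weights: "convex_weights (?A i) (\<mu> i)" if "i \<in> {1..N}" for i
    using \<mu> that by (auto simp: balanced_weights_def)
  have finU: "finite (U i)" and sumU: "(\<Sum>\<pi>\<in>U i. \<mu> i \<pi>) = 1" if "i \<in> {1..N}" for i
    using weights[OF that] by (auto simp: convex_weights_def U_def)
  have argmax: "\<pi> \<in> ?A i" if "\<pi> \<in> U i" for i \<pi>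
    using that by (simp add: U_def weight_support_def)
  have inS: "\<pi> \<in> S" if "\<pi> \<in> U i" for i \<pi>
    using argmax[OF that] dual_argmax_subset by blast
  have finI: "finite I" unfolding I_def using finU by (intro finite_SigmaI) auto
  have w0: "0 \<le> w j" if "j \<in> I" for j
    using that weights by (auto simp: I_def U_def w_def convex_weights_def weight_support_def)
  have sumI: "(\<Sum>j\<in>I. w j * f j) = 1 / real N * (\<Sum>i\<in>{1..N}. \<Sum>\<pi>\<in>U i. \<mu> i \<pi> * f (i, \<pi>))" for f
  proof -
    have "(\<Sum>j\<in>I. w j * f j) = (\<Sum>i\<in>{1..N}. \<Sum>\<pi>\<in>U i. w (i, \<pi>) * f (i, \<pi>))"
      unfolding I_def using finU by (subst sum.Sigma) (auto simp: case_prod_unfold)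
    then show ?thesis by (simp add: w_def sum_distrib_left mult.assoc)
  qed
  define G where "G i = (\<Sum>\<pi>\<in>U i. \<mu> i \<pi> * ((lp_norm q \<pi>)\<^sup>2 / (4 * l\<^sup>2)))" for i
  have budget: "1 / real N * (\<Sum>i\<in>{1..N}. G i) = \<epsilon>\<^sup>2"
    using \<mu> by (simp add: balanced_weights_def U_def G_def)
  have aI: "a ` I \<subseteq> \<Xi>"
    using \<zeta> up shifted_point_ge[OF l] inS by (fastforce simp: I_def a_def)
  have zI: "(\<zeta> \<circ> fst) ` I \<subseteq> \<Xi>" using \<zeta> by (auto simp: I_def)
  have prob: "prob_space Q"
    unfolding Q
  proof (rule prob_space_dirac_sum[OF finI aI w0])
    show "(\<Sum>j\<in>I. w j) = 1" using sumI[of "\<lambda>_. 1"] sumU N by simp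
  qed
  have empirical: "dirac_sum \<Xi> I w (\<zeta> \<circ> fst) = empirical_measure \<Xi> N \<zeta>"
    unfolding empirical_measure_def
  proof (rule dirac_sum_reindex)
    fix i assume i: "i \<in> {1..N}"
    have "{j \<in> I. fst j = i} = Pair i ` U i" using i by (auto simp: I_def)
    then have "(\<Sum>j\<in>{j \<in> I. fst j = i}. w j) = (\<Sum>\<pi>\<in>U i. w (i, \<pi>))"
      by (simp add: sum.reindex inj_on_def)
    also have "\<dots> = 1 / real N" using sumU[OF i] by (simp add: w_def flip: sum_divide_distrib)
    finally show "(\<Sum>j\<in>{j \<in> I. fst j = i}. w j) = 1 / real N" .
  qed (use \<zeta> finI w0 in \<open>auto simp: I_def\<close>)
  have "(\<Sum>j\<in>I. w j * (lp_norm p (a j - (\<zeta> \<circ> fst) j))\<^sup>2) =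
      1 / real N * (\<Sum>i\<in>{1..N}. G i)"
    unfolding sumI G_def using inS
    by (intro arg_cong2[where f = "(*)"] sum.cong refl)
      (simp add: a_def shifted_point_distance[OF l] power_divide power_mult_distrib)
  then have "wasserstein p 2 (dirac_sum \<Xi> I w a) (dirac_sum \<Xi> I w (\<zeta> \<circ> fst)) \<le> ennreal \<epsilon>"
    using budget by (intro wasserstein_dirac_sum_le[OF p finI aI zI w0 _ \<epsilon>]) auto
  then have "wasserstein p 2 Q (empirical_measure \<Xi> N \<zeta>) \<le> ennreal \<epsilon>"
    by (simp add: Q empirical)
  moreover have "integrable Q (\<lambda>\<xi>. lp_norm p \<xi> powr 2)"
    unfolding Q
    by (intro integrable_dirac_sum[OF finI aI] powr_real_measurable lp_norm_measurable[OF p]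
        borel_measurable_const)
  ultimately show "Q \<in> ambiguity_set p 2 \<Xi> N \<zeta> \<epsilon>"
    using prob by (simp add: ambiguity_set_def prob_moment_def Q sets_dirac_sum)
  have "(\<integral>\<xi>. Z \<xi> \<partial>Q) = (\<Sum>j\<in>I. w j * Z (a j))"
    unfolding Q by (rule integral_dirac_sum[OF finI aI w0 cost_measurable])
  also have "\<dots> = 1 / real N * (\<Sum>i\<in>{1..N}. \<Sum>\<pi>\<in>U i.
      \<mu> i \<pi> * penalized_cost l (\<zeta> i) + l * (\<mu> i \<pi> * ((lp_norm q \<pi>)\<^sup>2 / (4 * l\<^sup>2))))"
    unfolding sumI using argmax l
    by (intro arg_cong2[where f = "(*)"] sum.cong refl)
      (simp add: a_def cost_at_shifted_point[OF l] distrib_left power2_eq_square)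
  also have "\<dots> = 1 / real N * (\<Sum>i\<in>{1..N}. penalized_cost l (\<zeta> i) + l * G i)"
    using sumU
    by (intro arg_cong2[where f = "(*)"] sum.cong refl)
      (simp add: G_def sum.distrib sum_distrib_left flip: sum_distrib_right)
  also have "\<dots> = 1 / real N * (\<Sum>i\<in>{1..N}. penalized_cost l (\<zeta> i)) + l * \<epsilon>\<^sup>2"
    by (simp add: budget[symmetric] sum.distrib distrib_left flip: sum_distrib_left)
  finally show "(\<integral>\<xi>. Z \<xi> \<partial>Q) =
      \<epsilon>\<^sup>2 * l + 1 / real N * (\<Sum>i\<in>{1..N}. penalized_cost l (\<zeta> i))"
    by (simp add: mult.commute)
qed

end

section \<open>The two-stage problem\<close>

theorem proposition4:
  fixes K :: "(real^'ny) set" and c :: "real^'ny"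
    and W :: "real^'ny^'k" and T :: "real^'nx^'k" and x :: "real^'nx"
    and p q :: ereal and \<Xi> :: "(real^'k) set"
    and N :: nat and \<zeta> :: "nat \<Rightarrow> real^'k" and \<epsilon> lam :: real
  defines "Z \<equiv> second_stage_cost K c W T x"
    and "Pi_d \<equiv> dual_feasible K c W"
    and "PiS \<equiv> (\<lambda>i. dual_argmax q (dual_feasible K c W) (T *v x + \<zeta> i) lam)"
    and "\<P> \<equiv> ambiguity_set p 2 \<Xi> N \<zeta> \<epsilon>"
  assumes "product_of_proper_cones K"
    and "complete_recourse K W"
    and "interior Pi_d \<noteq> {}"
    and "1 \<le> p" and "1 \<le> q" and "1 / p + 1 / q = 1"
    and "\<Xi> = UNIV \<or> \<Xi> = {\<xi>. 0 \<le> \<xi>}"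
    and "1 \<le> N" and "\<And>i. i \<in> {1..N} \<Longrightarrow> \<zeta> i \<in> \<Xi>"
    and "0 < \<epsilon>"
    and "optimal_multiplier p Z \<Xi> N \<zeta> \<epsilon> lam"
  shows "0 < lam \<and>
    (\<exists>\<mu>. balanced_weights q N \<epsilon> lam PiS \<mu>) \<and>
    (\<forall>\<mu>. balanced_weights q N \<epsilon> lam PiS \<mu> \<longrightarrow>
       worst_case_distribution q \<Xi> N \<zeta> lam PiS \<mu> \<in> \<P> \<and>
       ereal (\<integral>\<xi>. Z \<xi> \<partial>worst_case_distribution q \<Xi> N \<zeta> lam PiS \<mu>) = worst_case_expectation Z \<P>)"
proof -
  have ne: "Pi_d \<noteq> {}" using assms(7) by auto
  interpret max_affine_cost Pi_d "T *v x" Z p q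
  proof
    show "compact Pi_d" unfolding Pi_d_def by (rule compact_dual_feasible) fact
    show "0 \<le> \<pi>" if "\<pi> \<in> Pi_d" for \<pi> using that dual_feasibleD(1) by (auto simp: Pi_d_def)
    show "\<pi> \<bullet> (T *v x + \<xi>) \<le> Z \<xi>" if "\<pi> \<in> Pi_d" for \<pi> \<xi>
      using that assms(6) unfolding Pi_d_def Z_def by (intro second_stage_cost_ge)
    show "\<exists>\<pi>\<in>Pi_d. Z \<xi> = \<pi> \<bullet> (T *v x + \<xi>)" for \<xi>
      using ne product_of_proper_cones_imp_cone[OF assms(5)] assms(6)
      unfolding Pi_d_def Z_def by (intro second_stage_cost_attained)
  qed fact+
  have up: "\<xi>' \<in> \<Xi>" if "\<xi> \<in> \<Xi>" "\<xi> \<le> \<xi>'" for \<xi> \<xi>'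
    using assms(11) that by (auto intro: order_trans)
  obtain \<pi> where \<pi>: "\<pi> \<in> Pi_d" "\<pi> \<noteq> 0"
    using assms(7) interior_mono[of Pi_d "{0}"] by (cases "Pi_d \<subseteq> {0}") auto
  have lam0: "0 \<le> lam"
    using assms(15) by (simp add: optimal_multiplier_def is_arg_min_def)
  have min: "lagrange_dual p Z \<Xi> N \<zeta> \<epsilon> lam \<le> lagrange_dual p Z \<Xi> N \<zeta> \<epsilon> k" if "0 \<le> k" for k
    using assms(15) that by (auto simp: optimal_multiplier_def is_arg_min_linorder)
  note dual_eq = lagrange_dual_eq[of _ N \<zeta> \<Xi> \<epsilon>, OF _ assms(13) up]
  have "lam \<noteq> 0"
  proof
    assume "lam = 0"
    then have "lagrange_dual p Z \<Xi> N \<zeta> \<epsilon> lam = \<infinity>"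
      using lagrange_dual_at_zero[OF assms(12,13) up \<pi>] by simp
    then show False using min[of 1] dual_eq[of 1] by simp
  qed
  then have lam: "0 < lam" using lam0 by simp
  have PiS: "PiS = (\<lambda>i. dual_argmax q Pi_d (T *v x + \<zeta> i) lam)"
    by (simp add: PiS_def Pi_d_def)
  have "\<exists>\<mu>. balanced_weights q N \<epsilon> lam PiS \<mu>"
    unfolding PiS dual_argmax_eq
  proof (rule balanced_weights_exist[OF compact nonempty q assms(12) continuous_objective(1) lam])
    fix k :: real assume k: "0 < k"
    then show "\<epsilon>\<^sup>2 * lam + 1 / real N * (\<Sum>i\<in>{1..N}. perturbed_max Pi_d (\<lambda>\<pi>. \<pi> \<bullet> (T *v x + \<zeta> i)) (\<lambda>\<pi>. (lp_norm q \<pi>)\<^sup>2) (1 / (4 * lam)))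
      \<le> \<epsilon>\<^sup>2 * k + 1 / real N * (\<Sum>i\<in>{1..N}. perturbed_max Pi_d (\<lambda>\<pi>. \<pi> \<bullet> (T *v x + \<zeta> i)) (\<lambda>\<pi>. (lp_norm q \<pi>)\<^sup>2) (1 / (4 * k)))"
      using min[of k] dual_eq[OF lam] dual_eq[OF k] unfolding penalized_cost_def by simp
  qed
  moreover have "worst_case_distribution q \<Xi> N \<zeta> lam PiS \<mu> \<in> \<P> \<and>
      ereal (\<integral>\<xi>. Z \<xi> \<partial>worst_case_distribution q \<Xi> N \<zeta> lam PiS \<mu>) = worst_case_expectation Z \<P>"
    if \<mu>: "balanced_weights q N \<epsilon> lam PiS \<mu>" for \<mu>
  proof
    let ?Q = "worst_case_distribution q \<Xi> N \<zeta> lam PiS \<mu>"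
    have \<epsilon>: "0 \<le> \<epsilon>" using assms(14) by simp
    note opt = worst_case_distribution_optimal[OF assms(12,13) up \<epsilon> lam \<mu>[unfolded PiS], folded PiS]
    show Q: "?Q \<in> \<P>" unfolding \<P>_def by (rule opt(1))
    have "worst_case_expectation Z \<P> = ereal (\<integral>\<xi>. Z \<xi> \<partial>?Q)"
      unfolding worst_case_expectation_def
    proof (rule SUP_eqI)
      fix P assume "P \<in> \<P>"
      then show "ereal (\<integral>\<xi>. Z \<xi> \<partial>P) \<le> ereal (\<integral>\<xi>. Z \<xi> \<partial>?Q)"
        using expectation_le_lagrangian[OF _ assms(12,13) \<epsilon> lam, of P] opt(2) by (simp add: \<P>_def)
    qed (use Q in blast)
    then show "ereal (\<integral>\<xi>. Z \<xi> \<partial>?Q) = worst_case_expectation Z \<P>" by simp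
  qed
  ultimately show ?thesis using lam by blast
qed

end
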